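(* There are absolute constants $C,c>0$ such that for all integers $L,T\ge 1$ the following holds. Let $D(L,T)$ be the supremum of $|f(X,S)-E(X,S)|$ over all odd or even initial configurations of the Propp machine on $\mathbb{Z}$, all intervals $X\subseteq\mathbb{Z}$ of length $L$, and all intervals $S\subseteq\mathbb{N}_0$ of length $T$. Then: - if $L\ge 2T^{1/2}$, then $c\,T\log(LT^{-1/2})\le D(L,T)\le C\,T\log(LT^{-1/2})$; - otherwise, $c\,L\,T^{1/2}\le D(L,T)\le C\,L\,T^{1/2}$.
   Context: $\mathbb{N}_0$ is the set of non-negative integers. An interval of length $n$ in $\mathbb{Z}$ (or $\mathbb{N}_0$) is a set of $n$ consecutive elements. Propp machine on $\mathbb{Z}$: at each time $t\in\mathbb{N}_0$, each vertex $x\in\mathbb{Z}$ holds a number $f(x,t)\in\mathbb{N}_0$ of chips and an arrow $\mathrm{ARR}(x,t)\in\{-1,+1\}$ ($+1$ = right, $-1$ = left). The initial configuration (the values $f(x,0)$ and $\mathrm{ARR}(x,0)$, $x\in\mathbb{Z}$; infinitely many vertices may hold chips) determines all later configurations by $$f(x,t+1)=\tfrac12 f(x-1,t)+\tfrac12 f(x+1,t)+\tfrac12\mathrm{ARR}(x-1,t)\,(f(x-1,t)\bmod 2)-\tfrac12\mathrm{ARR}(x+1,t)\,(f(x+1,t)\bmod 2),$$ $$\mathrm{ARR}(x,t+1)=(-1)^{f(x,t)}\,\mathrm{ARR}(x,t).$$ A configuration is even if no chip is at an odd position, and odd if no chip is at an even position (arrows are unrestricted). $E(x,t)$ is the expected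 number of chips at $x$ after all chips of the initial configuration perform independent simple random walks for $t$ steps, i.e. $E(x,t)=\sum_{y\in\mathbb{Z}}f(y,0)\,H(x-y,t)$ (a finite sum), where $H(z,t)=2^{-t}\binom{t}{(t+z)/2}$ if $t-z$ is even (which is $0$ if $|z|>t$) and $H(z,t)=0$ otherwise. For finite $X\subseteq\mathbb{Z}$ and finite $S\subseteq\mathbb{N}_0$, $f(X,S):=\sum_{x\in X}\sum_{t\in S}f(x,t)$ and $E(X,S):=\sum_{x\in X}\sum_{t\in S}E(x,t)$. *)

theory Defs
  imports "HOL-Analysis.Analysis"
begin

(* The subtraction takes place in int, and the division and the conversion to nat are exact
   as long as all arrows are 1 or -1; see chips_Suc below. *)
fun chips :: "(int \<Rightarrow> nat) \<Rightarrow> (int \<Rightarrow> int) \<Rightarrow> int \<Rightarrow> nat \<Rightarrow> nat"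
  and arrow :: "(int \<Rightarrow> nat) \<Rightarrow> (int \<Rightarrow> int) \<Rightarrow> int \<Rightarrow> nat \<Rightarrow> int"
where
  "chips f0 A0 x 0 = f0 x"
| "chips f0 A0 x (Suc t) =
    nat ((int (chips f0 A0 (x - 1) t) + int (chips f0 A0 (x + 1) t)
          + arrow f0 A0 (x - 1) t * int (chips f0 A0 (x - 1) t mod 2)
          - arrow f0 A0 (x + 1) t * int (chips f0 A0 (x + 1) t mod 2)) div 2)"
| "arrow f0 A0 x 0 = A0 x"
| "arrow f0 A0 x (Suc t) = (- 1) ^ chips f0 A0 x t * arrow f0 A0 x t"

definition valid_arrows :: "(int \<Rightarrow> int) \<Rightarrow> bool" where
  "valid_arrows A0 \<longleftrightarrow> (\<forall>x. A0 x \<in> {- 1, 1})"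

definition even_config :: "(int \<Rightarrow> nat) \<Rightarrow> bool" where
  "even_config f0 \<longleftrightarrow> (\<forall>x. odd x \<longrightarrow> f0 x = 0)"

definition odd_config :: "(int \<Rightarrow> nat) \<Rightarrow> bool" where
  "odd_config f0 \<longleftrightarrow> (\<forall>x. even x \<longrightarrow> f0 x = 0)"

(* The guard on the absolute value is needed because nat maps negative integers to 0. *)
definition walk_prob :: "int \<Rightarrow> nat \<Rightarrow> real" where
  "walk_prob z t =
    (if even (int t - z) \<and> \<bar>z\<bar> \<le> int t
     then real (t choose nat ((int t + z) div 2)) / 2 ^ t else 0)"

definition expected_chips :: "(int \<Rightarrow> nat) \<Rightarrow> int \<Rightarrow> nat \<Rightarrow> real" where
  "expected_chips f0 x t = (\<Sum>\<^sub>\<infinity>y\<in>UNIV. real (f0 y) * walk_prob (x - y) t)"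

definition chips_on :: "(int \<Rightarrow> nat) \<Rightarrow> (int \<Rightarrow> int) \<Rightarrow> int set \<Rightarrow> nat set \<Rightarrow> nat" where
  "chips_on f0 A0 X S = (\<Sum>x\<in>X. \<Sum>t\<in>S. chips f0 A0 x t)"

definition expected_on :: "(int \<Rightarrow> nat) \<Rightarrow> int set \<Rightarrow> nat set \<Rightarrow> real" where
  "expected_on f0 X S = (\<Sum>x\<in>X. \<Sum>t\<in>S. expected_chips f0 x t)"

definition int_interval :: "nat \<Rightarrow> int set \<Rightarrow> bool" where
  "int_interval n X \<longleftrightarrow> (\<exists>a. X = {a..<a + int n})"

definition nat_interval :: "nat \<Rightarrow> nat set \<Rightarrow> bool" where
  "nat_interval n S \<longleftrightarrow> (\<exists>s. S = {s..<s + n})"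

(* Taken in ereal, so that an unbounded family would have supremum infinity. *)
definition max_discrepancy :: "nat \<Rightarrow> nat \<Rightarrow> ereal" where
  "max_discrepancy L T =
    Sup {ereal \<bar>real (chips_on f0 A0 X S) - expected_on f0 X S\<bar> | f0 A0 X S.
      valid_arrows A0 \<and> (even_config f0 \<or> odd_config f0) \<and>
      int_interval L X \<and> nat_interval T S}"

lemma arrow_range:
  assumes "valid_arrows A0"
  shows "arrow f0 A0 x t \<in> {- 1, 1}"
proof (induction t)
  case 0
  then show ?case using assms by (simp add: valid_arrows_def)
next
  case (Suc t)
  then show ?case by (cases "even (chips f0 A0 x t)") auto
qed

lemma chips_Suc:
  assumes "valid_arrows A0"
  shows "real (chips f0 A0 x (Suc t)) =
    1/2 * real (chips f0 A0 (x - 1) t) + 1/2 * real (chips f0 A0 (x + 1) t)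
    + 1/2 * real_of_int (arrow f0 A0 (x - 1) t) * real (chips f0 A0 (x - 1) t mod 2)
    - 1/2 * real_of_int (arrow f0 A0 (x + 1) t) * real (chips f0 A0 (x + 1) t mod 2)"
proof -
  define p q a b where "p = chips f0 A0 (x - 1) t" and "q = chips f0 A0 (x + 1) t"
    and "a = arrow f0 A0 (x - 1) t" and "b = arrow f0 A0 (x + 1) t"
  define n where "n = int p + int q + a * int (p mod 2) - b * int (q mod 2)"
  have ab: "a = - 1 \<or> a = 1" "b = - 1 \<or> b = 1"
    using arrow_range[OF assms] by (auto simp: a_def b_def)
  have "0 \<le> n \<and> even n"
    using ab unfolding n_def by (elim disjE; simp; presburger)
  then have "real (nat (n div 2)) = real_of_int n / 2"
    by (auto elim!: evenE)
  moreover have "chips f0 A0 x (Suc t) = nat (n div 2)"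
    by (simp only: chips.simps n_def p_def q_def a_def b_def)
  ultimately have "real (chips f0 A0 x (Suc t)) = real_of_int n / 2"
    by (simp only:)
  also have "\<dots> = 1/2 * real p + 1/2 * real q
      + 1/2 * real_of_int a * real (p mod 2) - 1/2 * real_of_int b * real (q mod 2)"
    by (simp add: n_def field_simps)
  finally show ?thesis
    by (simp only: p_def q_def a_def b_def)
qed

lemma expected_chips_finite_sum:
  "expected_chips f0 x t = (\<Sum>y\<in>{x - int t..x + int t}. real (f0 y) * walk_prob (x - y) t)"
proof -
  have "expected_chips f0 x t =
      (\<Sum>\<^sub>\<infinity>y\<in>{x - int t..x + int t}. real (f0 y) * walk_prob (x - y) t)"
    unfolding expected_chips_def by (rule infsum_cong_neutral) (auto simp: walk_prob_def)
  then show ?thesis by simp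
qed

end

theory Submission
  imports Defs
begin

text \<open>
  The machine differs from the random walk only in that a vertex holding an odd number of chips
  sends its last chip in the direction of its arrow instead of splitting it. Let \<^emph>\<open>kick\<close> be
  the sign of that arrow at an odd vertex, and \<open>0\<close> at an even one. Linearity gives an exact
  formula (\<open>discrepancy_at\<close>):
  the discrepancy at \<open>(x, t)\<close> is half the sum, over all vertices \<open>y\<close> and times \<open>s < t\<close>, of the
  kick at \<open>(y, s)\<close> times \<open>walk_drop (x - y) (t - s - 1)\<close>, where
  \<open>walk_drop z u = H(z - 1, u) - H(z + 1, u)\<close> measures how much the kicked chip shifts the walk.
  Two features of the two factors carry the proof. The kicks of one vertex alternate in sign, so
  that over any interval of times they sum to at most \<open>1\<close> in absolute value. And \<open>walk_drop z\<close> is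
  odd in \<open>z\<close> and, for \<open>z \<ge> 1\<close>, twice the probability that the walk first hits \<open>z\<close> at time
  \<open>u + 1\<close>: it has bounded sum over \<open>u\<close>, and it is unimodal in \<open>u\<close> with a maximum of order
  \<open>1 / z\<^sup>2\<close>, attained at \<open>u\<close> of order \<open>z\<^sup>2\<close>.

  Upper bound. Fix a vertex \<open>y\<close> and a distance \<open>z \<ge> 1\<close>, and sum its influence at distance \<open>z\<close> over
  the \<open>T\<close> times of the interval. Summing the kicks first bounds this by a constant
  (\<open>influence_le_4\<close>); summing an alternating sequence against a unimodal one bounds it by a
  constant times \<open>T / z\<^sup>2\<close> (\<open>influence_le_decay\<close>). As the influence is odd in \<open>z\<close>, the
  contributions of \<open>y + z\<close> and \<open>y - z\<close> cancel if both lie in the space interval, so that for each \<open>z\<close>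
  at most \<open>min (2 L) (4 z)\<close> vertices \<open>y\<close> count (\<open>card_unbalanced_le\<close>). Hence the discrepancy is at
  most of the order of the sum over \<open>z \<ge> 1\<close> of \<open>min L z * min 1 (T / z\<^sup>2)\<close>. If \<open>L < 2 \<surd>T\<close>, then
  bounding the first factor by \<open>L\<close> gives \<open>L \<surd>T\<close>; if \<open>L \<ge> 2 \<surd>T\<close>, then the range \<open>\<surd>T < z \<le> L\<close>
  contributes \<open>T\<close> times a harmonic sum, and the rest only \<open>T\<close>.

  Lower bound. An even configuration can realise any parities whatsoever up to a given time
  (\<open>parity_forcing\<close>), since adding \<open>2\<^sup>t\<close> chips to a pile leaves all parities before time \<open>t\<close>
  unchanged. Place a single kick at each vertex \<open>- z\<close> to the left of the space interval
  \<open>{0..<L}\<close>, at about the time before the time interval at which \<open>walk_drop z\<close> is of its maximal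
  order, that is \<open>9 z\<^sup>2\<close> steps earlier. All kicks point to the right and all contributions are
  positive; with \<open>z\<^sup>2 \<ge> T\<close>, that of \<open>- z\<close> is of order \<open>T * min L z / z\<^sup>2\<close>
  (\<open>max_discrepancy_ge\<close>). Summing over \<open>\<surd>T \<le> z \<le> L\<close>, respectively \<open>\<surd>T \<le> z \<le> 2 \<surd>T\<close>, gives the two
  bounds.
\<close>

section \<open>Transition probabilities of the simple random walk\<close>

lemma walk_prob_eq_0:
  assumes "odd (int t - z) \<or> \<bar>z\<bar> > int t"
  shows "walk_prob z t = 0"
  using assms by (auto simp: walk_prob_def)

lemma walk_prob_binomial:
  assumes "z + int n = 2 * int k"
  shows "walk_prob z n = real (n choose k) / 2 ^ n"
proof -
  have z: "z = 2 * int k - int n" using assms by simp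
  show ?thesis
    by (cases "k \<le> n") (auto simp: walk_prob_def z)
qed

lemma walk_prob_cases:
  obtains (zero) "odd (int t - z) \<or> \<bar>z\<bar> > int t" "walk_prob z t = 0"
  | (binomial) k where "z = 2 * int k - int t" "k \<le> t" "walk_prob z t = real (t choose k) / 2 ^ t"
proof (cases "odd (int t - z) \<or> \<bar>z\<bar> > int t")
  case True
  then show ?thesis using zero walk_prob_eq_0 by blast
next
  case False
  define k where "k = nat ((int t + z) div 2)"
  have "z = 2 * int k - int t" "k \<le> t"
    using False by (auto simp: k_def)
  then show ?thesis using binomial walk_prob_binomial[of z t k] by simp
qed

lemma walk_prob_nonneg [simp]: "walk_prob z t \<ge> 0"
  by (simp add: walk_prob_def)

lemma walk_prob_0: "walk_prob z 0 = (if z = 0 then 1 else 0)"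
  by (auto simp: walk_prob_def)

lemma walk_prob_minus [simp]: "walk_prob (- z) t = walk_prob z t"
proof (cases z t rule: walk_prob_cases)
  case zero
  then show ?thesis by (auto intro!: walk_prob_eq_0)
next
  case (binomial k)
  have "- z = 2 * int (t - k) - int t" using binomial by simp
  then have "walk_prob (- z) t = real (t choose (t - k)) / 2 ^ t"
    by (intro walk_prob_binomial) simp
  then show ?thesis using binomial binomial_symmetric[of k t] by simp
qed

lemma walk_prob_Suc:
  "walk_prob z (Suc t) = (walk_prob (z - 1) t + walk_prob (z + 1) t) / 2"
proof (cases z "Suc t" rule: walk_prob_cases)
  case zero
  have "walk_prob (z - 1) t = 0" "walk_prob (z + 1) t = 0"
    by (rule walk_prob_eq_0, use zero(1) in \<open>elim disjE; simp; linarith\<close>)+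
  then show ?thesis using zero by simp
next
  case (binomial k)
  have 1: "walk_prob (z + 1) t = real (t choose k) / 2 ^ t"
    using binomial by (intro walk_prob_binomial) simp
  show ?thesis
  proof (cases k)
    case 0
    then have "walk_prob (z - 1) t = 0" using binomial by (intro walk_prob_eq_0) auto
    then show ?thesis using 1 0 binomial by simp
  next
    case (Suc j)
    then have "walk_prob (z - 1) t = real (t choose j) / 2 ^ t"
      using binomial by (intro walk_prob_binomial) simp
    then show ?thesis using 1 Suc by (simp add: binomial(3) add_divide_distrib)
  qed
qed

lemma sum_walk_prob_le_1: "(\<Sum>x\<in>{a..b}. walk_prob x t) \<le> 1"
proof (induction t arbitrary: a b)
  case 0
  have "(\<Sum>x\<in>{a..b}. walk_prob x 0) = (if 0 \<in> {a..b} then 1 else 0)"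
    by (simp add: walk_prob_0)
  then show ?case by simp
next
  case (Suc t)
  have "(\<Sum>x\<in>{a..b}. walk_prob x (Suc t)) =
      ((\<Sum>x\<in>{a..b}. walk_prob (x - 1) t) + (\<Sum>x\<in>{a..b}. walk_prob (x + 1) t)) / 2"
    by (simp add: walk_prob_Suc sum.distrib flip: sum_divide_distrib)
  also have "(\<Sum>x\<in>{a..b}. walk_prob (x - 1) t) = (\<Sum>x\<in>{a - 1..b - 1}. walk_prob x t)"
    by (rule sum.reindex_bij_witness[of _ "\<lambda>x. x + 1" "\<lambda>x. x - 1"]) auto
  also have "(\<Sum>x\<in>{a..b}. walk_prob (x + 1) t) = (\<Sum>x\<in>{a + 1..b + 1}. walk_prob x t)"
    by (rule sum.reindex_bij_witness[of _ "\<lambda>x. x - 1" "\<lambda>x. x + 1"]) auto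
  also have "((\<Sum>x\<in>{a - 1..b - 1}. walk_prob x t) + (\<Sum>x\<in>{a + 1..b + 1}. walk_prob x t)) / 2 \<le> 1"
    using Suc[of "a - 1" "b - 1"] Suc[of "a + 1" "b + 1"] by simp
  finally show ?case .
qed

text \<open>The ratio of consecutive binomial weights at a fixed place. The form without quotients
  also holds where the walk cannot be.\<close>

lemma walk_prob_add_2:
  "walk_prob z (n + 2) * ((real n + 2)\<^sup>2 - (real_of_int z)\<^sup>2) =
    walk_prob z n * ((real n + 1) * (real n + 2))"
proof (cases z "n + 2" rule: walk_prob_cases)
  case zero
  then have "walk_prob z n = 0" by (intro walk_prob_eq_0) auto
  then show ?thesis using zero by simp
next
  case (binomial k)
  show ?thesis
  proof (cases "k = 0 \<or> k = n + 2")
    case True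
    then have z: "\<bar>z\<bar> = int n + 2" using binomial by auto
    then have "walk_prob z n = 0" by (intro walk_prob_eq_0) simp
    moreover have "(real_of_int z)\<^sup>2 = (real_of_int \<bar>z\<bar>)\<^sup>2" by simp
    ultimately show ?thesis using z by (simp del: of_int_abs power2_abs)
  next
    case False
    then obtain j where j: "k = Suc j" "j \<le> n" using binomial by (cases k) auto
    have h: "walk_prob z n = real (n choose j) / 2 ^ n"
      using binomial j by (intro walk_prob_binomial) simp
    have "Suc (n - j) * (Suc j * ((n + 2) choose Suc j)) = Suc (n - j) * ((n + 2) * (Suc n choose j))"
      using Suc_times_binomial[of j "Suc n"] by (simp del: binomial_Suc_Suc)
    also have "\<dots> = (n + 2) * (Suc n - j) * (Suc n choose j)"
      by (simp only: Suc_diff_le[OF j(2)] mult_ac)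
    also have "\<dots> = (n + 2) * ((n + 1) * (n choose j))"
      using binomial_absorb_comp[of "Suc n" j] by (simp only: mult.assoc) simp
    finally have key: "real (Suc (n - j)) * (real (Suc j) * real ((n + 2) choose Suc j)) =
        real (n + 2) * (real (n + 1) * real (n choose j))"
      by (simp only: flip: of_nat_mult)
    have zr: "real_of_int z = 2 * real j - real n"
      using j binomial by simp
    have sq: "(real n + 2)\<^sup>2 - (real_of_int z)\<^sup>2 = 4 * real (Suc (n - j)) * real (Suc j)"
      unfolding zr using j(2) by (simp add: of_nat_diff power2_eq_square algebra_simps)
    have "walk_prob z (n + 2) * ((real n + 2)\<^sup>2 - (real_of_int z)\<^sup>2) =
        real (Suc (n - j)) * (real (Suc j) * real ((n + 2) choose Suc j)) / 2 ^ n"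
      by (simp only: sq binomial(3) j(1)) (simp del: binomial_Suc_Suc of_nat_Suc)
    also have "\<dots> = walk_prob z n * ((real n + 1) * (real n + 2))"
      by (simp only: key h) (simp add: mult.commute add.commute)
    finally show ?thesis .
  qed
qed

section \<open>The influence of one displaced chip\<close>

text \<open>The difference that it makes at distance \<open>z\<close>, after \<open>u\<close> further steps, whether a chip has been
  sent to the right or to the left.\<close>

definition walk_drop :: "int \<Rightarrow> nat \<Rightarrow> real" where
  "walk_drop z u = walk_prob (z - 1) u - walk_prob (z + 1) u"

lemma walk_drop_minus: "walk_drop (- z) u = - walk_drop z u"
proof -
  have "walk_prob (- z - 1) u = walk_prob (z + 1) u" "walk_prob (- z + 1) u = walk_prob (z - 1) u"
    using walk_prob_minus[of "z + 1" u] walk_prob_minus[of "z - 1" u] by simp_all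
  then show ?thesis by (simp add: walk_drop_def)
qed

text \<open>The ballot identity: for \<open>z \<ge> 1\<close>, the factor \<open>z / (u + 1)\<close> turns the probability of being at
  \<open>z\<close> at time \<open>u + 1\<close> into that of being there for the first time.\<close>

lemma walk_drop_eq: "walk_drop z u = 2 * real_of_int z / real (Suc u) * walk_prob z (Suc u)"
proof (cases z "Suc u" rule: walk_prob_cases)
  case zero
  have "walk_prob (z - 1) u = 0" "walk_prob (z + 1) u = 0"
    by (rule walk_prob_eq_0, use zero(1) in \<open>elim disjE; simp; linarith\<close>)+
  then show ?thesis using zero by (simp add: walk_drop_def)
next
  case (binomial k)
  have 1: "walk_prob (z + 1) u = real (u choose k) / 2 ^ u"
    using binomial by (intro walk_prob_binomial) simp
  show ?thesis
  proof (cases k)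
    case 0
    then have "walk_prob (z - 1) u = 0" "real_of_int z = - real (Suc u)"
      using binomial by (auto intro!: walk_prob_eq_0)
    then show ?thesis using 1 0 by (simp add: walk_drop_def binomial(3) divide_simps del: of_nat_Suc)
  next
    case (Suc j)
    then have 2: "walk_prob (z - 1) u = real (u choose j) / 2 ^ u"
      using binomial by (intro walk_prob_binomial) simp
    have "Suc j * (Suc u choose k) = Suc u * (u choose j)"
      using Suc_times_binomial[of j u] Suc by simp
    moreover have "(Suc u - k) * (Suc u choose k) = Suc u * (u choose k)"
      using binomial_absorb_comp[of "Suc u" k] by simp
    ultimately have "real (Suc j) * real (Suc u choose k) = real (Suc u) * real (u choose j)"
      "real (Suc u - k) * real (Suc u choose k) = real (Suc u) * real (u choose k)"
      by (simp_all only: flip: of_nat_mult)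
    then have "(real k - real (Suc u - k)) * real (Suc u choose k) =
        real (Suc u) * (real (u choose j) - real (u choose k))"
      using Suc by (simp only: left_diff_distrib right_diff_distrib)
    moreover have "real k - real (Suc u - k) = real_of_int z"
      using binomial by (simp add: of_nat_diff)
    ultimately have "real_of_int z * real (Suc u choose k) =
        real (Suc u) * (real (u choose j) - real (u choose k))" by simp
    then have "2 * real_of_int z / real (Suc u) * walk_prob z (Suc u) =
        (real (u choose j) - real (u choose k)) / 2 ^ u"
      by (simp add: binomial(3) divide_simps del: of_nat_Suc binomial_Suc_Suc)
    then show ?thesis using 1 2 by (simp add: walk_drop_def diff_divide_distrib)
  qed
qed

lemma walk_drop_nonneg: "z \<ge> 0 \<Longrightarrow> walk_drop z u \<ge> 0"
  by (simp add: walk_drop_eq)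

lemma walk_drop_eq_0:
  assumes "even (int u - z) \<or> \<bar>z\<bar> > int u + 1"
  shows "walk_drop z u = 0"
  using walk_prob_eq_0[of "Suc u" z] assms by (auto simp: walk_drop_eq)

text \<open>With \<open>S\<^sub>u\<close> the position of the walk at time \<open>u\<close>, the quantity \<open>P(S\<^sub>u \<ge> z) + P(S\<^sub>u \<ge> z + 1)\<close> is
  at most \<open>2\<close> and grows by exactly half of \<open>walk_drop z u\<close> in the step from \<open>u\<close> to \<open>u + 1\<close>.\<close>

lemma sum_walk_drop_le:
  assumes "z \<ge> 0"
  shows "(\<Sum>u<n. walk_drop z u) \<le> 4"
proof -
  \<comment> \<open>The walk does not pass \<open>M\<close> within \<open>n\<close> steps, so the probabilities \<open>Q\<close> are finite sums.\<close>
  define M where "M = z + int n"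
  define Q where "Q = (\<lambda>u. \<Sum>x\<in>{z..M}. walk_prob x u + walk_prob (x + 1) u)"
  have tele: "(\<Sum>x\<in>{z..z + int k}. walk_drop x u - walk_drop (x + 1) u) =
      walk_drop z u - walk_drop (z + int k + 1) u" for k u
  proof (induction k)
    case (Suc k)
    have "{z..z + int (Suc k)} = insert (z + int k + 1) {z..z + int k}" by auto
    then show ?case using Suc by (simp add: add_ac)
  qed simp
  have step: "2 * (Q (Suc u) - Q u) = walk_drop z u" if "u < n" for u
  proof -
    have "2 * (Q (Suc u) - Q u) = (\<Sum>x\<in>{z..M}. walk_drop x u - walk_drop (x + 1) u)"
      unfolding Q_def sum_subtractf[symmetric] sum_distrib_left
      by (intro sum.cong refl) (simp add: walk_drop_def walk_prob_Suc field_simps)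
    also have "\<dots> = walk_drop z u"
      using tele[of u n] walk_drop_eq_0[of u "z + int n + 1"] assms that by (simp add: M_def)
    finally show ?thesis .
  qed
  have "(\<Sum>u<m. walk_drop z u) = 2 * (Q m - Q 0)" if "m \<le> n" for m
    using that by (induction m) (auto simp: step[symmetric])
  then have "(\<Sum>u<n. walk_drop z u) = 2 * (Q n - Q 0)" by simp
  also have "\<dots> \<le> 2 * Q n" by (simp add: Q_def sum_nonneg)
  also have "Q n = (\<Sum>x\<in>{z..M}. walk_prob x n) + (\<Sum>x\<in>{z + 1..M + 1}. walk_prob x n)"
  proof -
    have "(\<Sum>x\<in>{z..M}. walk_prob (x + 1) n) = (\<Sum>x\<in>{z + 1..M + 1}. walk_prob x n)"
      by (rule sum.reindex_bij_witness[of _ "\<lambda>x. x - 1" "\<lambda>x. x + 1"]) auto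
    then show ?thesis by (simp add: Q_def sum.distrib)
  qed
  also have "2 * \<dots> \<le> 4"
    using sum_walk_prob_le_1[of n z M] sum_walk_prob_le_1[of n "z + 1" "M + 1"] by simp
  finally show ?thesis by simp
qed

lemma walk_drop_add_2:
  "walk_drop z (u + 2) * ((real u + 3)\<^sup>2 - (real_of_int z)\<^sup>2) =
    walk_drop z u * ((real u + 1) * (real u + 2))"
proof -
  have "walk_drop z (u + 2) * ((real u + 3)\<^sup>2 - (real_of_int z)\<^sup>2) =
     2 * real_of_int z / (real u + 3) * (walk_prob z (Suc u + 2) * ((real (Suc u) + 2)\<^sup>2 - (real_of_int z)\<^sup>2))"
    by (simp add: walk_drop_eq add_ac)
  also have "\<dots> = 2 * real_of_int z / (real u + 3) * (walk_prob z (Suc u) * ((real u + 2) * (real u + 3)))"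
    by (simp only: walk_prob_add_2) (simp add: add_ac)
  also have "\<dots> = walk_drop z u * ((real u + 1) * (real u + 2))"
    by (simp add: walk_drop_eq add_ac divide_simps)
  finally show ?thesis .
qed

text \<open>By \<open>walk_drop_add_2\<close>, comparing \<open>walk_drop z\<close> at \<open>u\<close> and \<open>u + 2\<close> amounts to comparing
  \<open>(u + 1) (u + 2)\<close> with \<open>(u + 3)\<^sup>2 - z\<^sup>2\<close>, that is, \<open>z\<^sup>2\<close> with \<open>3 u + 7\<close>. The steps have length \<open>2\<close>
  because \<open>walk_drop z\<close> vanishes at every other time.\<close>

lemma walk_drop_increasing:
  assumes "z \<ge> 0" "3 * int u + 7 \<le> z\<^sup>2"
  shows "walk_drop z u \<le> walk_drop z (u + 2)"
proof (cases "z > int u + 1")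
  case True
  then show ?thesis using walk_drop_eq_0[of u z] walk_drop_nonneg[OF assms(1), of "u + 2"] by simp
next
  case False
  have "3 * real u + 7 \<le> (real_of_int z)\<^sup>2" using assms(2) by (metis (mono_tags, opaque_lifting) of_int_add of_int_le_iff of_int_mult of_int_numeral of_int_of_nat_eq of_int_power)
  moreover have "(real_of_int z)\<^sup>2 < (real u + 3)\<^sup>2"
    using False assms(1) by (intro power_strict_mono) auto
  ultimately have pos: "0 < (real u + 3)\<^sup>2 - (real_of_int z)\<^sup>2" and
    le: "(real u + 3)\<^sup>2 - (real_of_int z)\<^sup>2 \<le> (real u + 1) * (real u + 2)"
    by (simp_all add: power2_eq_square algebra_simps)
  have "walk_drop z u * ((real u + 3)\<^sup>2 - (real_of_int z)\<^sup>2) \<le> walk_drop z u * ((real u + 1) * (real u + 2))"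
    using le by (intro mult_left_mono walk_drop_nonneg assms)
  also have "\<dots> = walk_drop z (u + 2) * ((real u + 3)\<^sup>2 - (real_of_int z)\<^sup>2)"
    by (rule walk_drop_add_2[symmetric])
  finally show ?thesis using pos by simp
qed

lemma walk_drop_decreasing:
  assumes "z \<ge> 0" "z\<^sup>2 < 3 * int u + 7"
  shows "walk_drop z (u + 2) \<le> walk_drop z u"
proof -
  have "z\<^sup>2 \<le> 3 * int u + 6" using assms(2) by simp
  then have "(real_of_int z)\<^sup>2 \<le> 3 * real u + 6" by (metis (mono_tags, opaque_lifting) of_int_add of_int_le_iff of_int_mult of_int_numeral of_int_of_nat_eq of_int_power)
  then have le: "(real u + 1) * (real u + 2) \<le> (real u + 3)\<^sup>2 - (real_of_int z)\<^sup>2"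
    by (simp add: power2_eq_square algebra_simps)
  have "walk_drop z (u + 2) * ((real u + 1) * (real u + 2)) \<le> walk_drop z (u + 2) * ((real u + 3)\<^sup>2 - (real_of_int z)\<^sup>2)"
    using le by (intro mult_left_mono walk_drop_nonneg assms)
  also have "\<dots> = walk_drop z u * ((real u + 1) * (real u + 2))"
    by (rule walk_drop_add_2)
  finally show ?thesis by (simp add: add_pos_nonneg)
qed

text \<open>The product of the squared probability with \<open>m\<close> increases with \<open>m\<close>, and that with \<open>2 m + 1\<close>
  decreases.\<close>

lemma central_binomial_bounds:
  assumes "m \<ge> 1"
  shows "1 / (2 * sqrt (real m)) \<le> walk_prob 0 (2 * m)"
    and "walk_prob 0 (2 * m) \<le> 1 / sqrt (2 * real m + 1)"
proof -
  have ratio: "walk_prob 0 (2 * Suc m) * (2 * real m + 2) = walk_prob 0 (2 * m) * (2 * real m + 1)" for m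
    using walk_prob_add_2[of 0 "2 * m"] by (simp add: power2_eq_square)
  have "1 / 4 \<le> (walk_prob 0 (2 * m))\<^sup>2 * real m" using assms
  proof (induction m rule: dec_induct)
    case base
    have "walk_prob 0 2 = 1 / 2" using walk_prob_binomial[of 0 2 1] by simp
    from arg_cong[OF this, of "\<lambda>p. p\<^sup>2"] show ?case by (simp add: power_divide)
  next
    case (step n)
    let ?a = "walk_prob 0 (2 * n)" and ?b = "walk_prob 0 (2 * Suc n)"
    have n: "n \<ge> 1" using step by simp
    have "4 * real n * (real n + 1) * (?a\<^sup>2 * real n) \<le> (2 * real n + 1)\<^sup>2 * (?a\<^sup>2 * real n)"
      by (intro mult_right_mono) (auto simp: power2_eq_square algebra_simps)
    also have "\<dots> = (?a * (2 * real n + 1))\<^sup>2 * real n" by (simp add: power_mult_distrib)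
    also have "\<dots> = (?b * (2 * real n + 2))\<^sup>2 * real n" by (simp only: ratio)
    also have "\<dots> = 4 * real n * (real n + 1) * (?b\<^sup>2 * real (Suc n))"
      by (simp add: power2_eq_square algebra_simps)
    finally have "?a\<^sup>2 * real n \<le> ?b\<^sup>2 * real (Suc n)" using n by simp
    then show ?case using step by simp
  qed
  then have "(1 / (2 * sqrt (real m)))\<^sup>2 \<le> (walk_prob 0 (2 * m))\<^sup>2"
    using assms by (simp add: power_mult_distrib power_divide field_simps)
  then show "1 / (2 * sqrt (real m)) \<le> walk_prob 0 (2 * m)"
    by (rule power2_le_imp_le) simp
  have "(walk_prob 0 (2 * m))\<^sup>2 * (2 * real m + 1) \<le> 1"
  proof (induction m)
    case 0
    then show ?case by (simp add: walk_prob_0)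
  next
    case (Suc n)
    let ?a = "walk_prob 0 (2 * n)" and ?b = "walk_prob 0 (2 * Suc n)"
    have "(2 * real n + 2)\<^sup>2 * (?b\<^sup>2 * (2 * real n + 3)) = (?b * (2 * real n + 2))\<^sup>2 * (2 * real n + 3)"
      by (simp add: power_mult_distrib)
    also have "\<dots> = (?a * (2 * real n + 1))\<^sup>2 * (2 * real n + 3)" by (simp only: ratio)
    also have "\<dots> = (2 * real n + 1) * (2 * real n + 3) * (?a\<^sup>2 * (2 * real n + 1))"
      by (simp add: power2_eq_square algebra_simps)
    also have "\<dots> \<le> (2 * real n + 2)\<^sup>2 * (?a\<^sup>2 * (2 * real n + 1))"
      by (intro mult_right_mono) (auto simp: power2_eq_square algebra_simps)
    finally have "?b\<^sup>2 * (2 * real n + 3) \<le> ?a\<^sup>2 * (2 * real n + 1)"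
      by (subst (asm) mult_le_cancel_left_pos) (auto simp: add_nonneg_pos)
    then show ?case using Suc by (simp add: algebra_simps)
  qed
  then have "(walk_prob 0 (2 * m))\<^sup>2 \<le> (1 / sqrt (2 * real m + 1))\<^sup>2"
    by (simp add: power_divide field_simps)
  then show "walk_prob 0 (2 * m) \<le> 1 / sqrt (2 * real m + 1)"
    by (rule power2_le_imp_le) simp
qed

lemma walk_prob_1_odd: "walk_prob 1 (2 * m + 1) = walk_prob 0 (2 * (m + 1))"
  using walk_prob_Suc[of 0 "2 * m + 1"] walk_prob_minus[of 1 "2 * m + 1"] by simp

lemma walk_prob_step_2:
  assumes "z \<ge> 0"
  shows "walk_prob (z + 2) n * (real n + real_of_int z + 2) = walk_prob z n * (real n - real_of_int z)"
proof -
  have avg: "walk_prob (z + 1) (Suc n) = (walk_prob z n + walk_prob (z + 2) n) / 2"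
    using walk_prob_Suc[of "z + 1" n] by (simp add: add.assoc)
  have "walk_prob z n - walk_prob (z + 2) n =
      2 * (real_of_int z + 1) / (real n + 1) * ((walk_prob z n + walk_prob (z + 2) n) / 2)"
    using walk_drop_eq[of "z + 1" n, unfolded avg] by (simp add: walk_drop_def add_ac)
  then show ?thesis by (simp add: field_simps)
qed

lemma walk_prob_le:
  assumes "n \<ge> 1"
  shows "walk_prob z n \<le> 1 / sqrt (real n)"
proof (cases z n rule: walk_prob_cases)
  case zero
  then show ?thesis by simp
next
  case (binomial k)
  have "walk_prob z n \<le> real (n choose (n div 2)) / 2 ^ n"
    using binomial binomial_maximum[of n k] by (simp add: divide_right_mono)
  also have "\<dots> \<le> 1 / sqrt (real n)"
  proof (cases "even n")
    case True
    then obtain m where m: "n = 2 * m" by (elim evenE)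
    then have "real (n choose (n div 2)) / 2 ^ n = walk_prob 0 (2 * m)"
      using walk_prob_binomial[of 0 n m] by simp
    also have "\<dots> \<le> 1 / sqrt (2 * real m + 1)" using m assms by (intro central_binomial_bounds) auto
    also have "\<dots> \<le> 1 / sqrt (real n)" using m assms by (intro divide_left_mono) auto
    finally show ?thesis .
  next
    case False
    then obtain m where m: "n = 2 * m + 1" by (elim oddE)
    then have "real (n choose (n div 2)) / 2 ^ n = walk_prob (- 1) n"
      using walk_prob_binomial[of "- 1" n m] by simp
    also have "\<dots> = walk_prob 0 (2 * (m + 1))"
      using walk_prob_minus[of 1 n] walk_prob_1_odd m by simp
    also have "\<dots> \<le> 1 / sqrt (2 * real (m + 1) + 1)" by (intro central_binomial_bounds) auto
    also have "\<dots> \<le> 1 / sqrt (real n)" using m by (intro divide_left_mono) auto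
    finally show ?thesis .
  qed
  finally show ?thesis .
qed

text \<open>Two steps away from the centre cost a factor \<open>(n - z) / (n + z + 2) \<ge> 1 - (2 z + 2) / n\<close>; the
  losses add up to at most \<open>z\<^sup>2 / n\<close>.\<close>

lemma walk_prob_ge:
  assumes "n \<ge> 1" "even (n + z)"
  shows "(1 - (real z)\<^sup>2 / real n) * (1 / (2 * sqrt (real n))) \<le> walk_prob (int z) n"
  using assms(2)
proof (induction z rule: nat_less_induct)
  case (1 z)
  consider "z = 0" | "z = 1" | y where "z = y + 2" by (metis One_nat_def add_2_eq_Suc' not0_implies_Suc)
  then show ?case
  proof cases
    case a: 1
    then obtain m where m: "n = 2 * m" using 1 by auto
    have "1 / (2 * sqrt (real n)) \<le> 1 / (2 * sqrt (real m))"
      using m assms by (intro divide_left_mono) auto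
    also have "\<dots> \<le> walk_prob 0 (2 * m)" using m assms by (intro central_binomial_bounds) auto
    finally show ?thesis using a m by simp
  next
    case a: 2
    then obtain m where m: "n = 2 * m + 1" using 1 by (auto elim: oddE)
    have "(1 - (real z)\<^sup>2 / real n) * (1 / (2 * sqrt (real n))) \<le> 1 * (1 / (2 * sqrt (real n)))"
      by (intro mult_right_mono) auto
    also have "\<dots> \<le> 1 / (2 * sqrt (real (m + 1)))"
      using m assms by (simp add: divide_left_mono)
    also have "\<dots> \<le> walk_prob 0 (2 * (m + 1))" by (intro central_binomial_bounds) auto
    finally show ?thesis using a m walk_prob_1_odd[of m] by simp
  next
    case (3 y)
    define h where "h = 1 / (2 * sqrt (real n))"
    have h: "h > 0" using assms by (simp add: h_def)
    have IH: "(1 - (real y)\<^sup>2 / real n) * h \<le> walk_prob (int y) n"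
      using 1 3 by (simp add: h_def)
    show ?thesis
    proof (cases "(real y + 2)\<^sup>2 \<le> real n")
      case False
      then have "1 - (real z)\<^sup>2 / real n \<le> 0" using 3 assms by (simp add: field_simps)
      then show ?thesis using h unfolding h_def[symmetric]
        by (meson mult_nonneg_nonneg mult_nonpos_nonneg order_trans less_imp_le walk_prob_nonneg)
    next
      case True
      have "real y \<le> (real y + 2)\<^sup>2" unfolding power2_sum by simp
      then have yn: "real y \<le> real n" using True by linarith
      have n: "real n > 0" using assms by simp
      have "(1 - (real z)\<^sup>2 / real n) * (real n + real y + 2) \<le> (1 - (real y)\<^sup>2 / real n) * (real n - real y)"
      proof -
        have "(real n - (real z)\<^sup>2) * (real n + real y + 2) \<le> (real n - (real y)\<^sup>2) * (real n - real y)"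
          using True 3 by (simp add: power2_eq_square algebra_simps)
        then have "(real n - (real z)\<^sup>2) * (real n + real y + 2) / real n
            \<le> (real n - (real y)\<^sup>2) * (real n - real y) / real n"
          using n by (intro divide_right_mono) auto
        moreover have "1 - w / real n = (real n - w) / real n" for w
          using n by (simp add: diff_divide_distrib)
        ultimately show ?thesis by simp
      qed
      then have "(1 - (real z)\<^sup>2 / real n) * (real n + real y + 2) * h \<le> (1 - (real y)\<^sup>2 / real n) * (real n - real y) * h"
        using h by (intro mult_right_mono) auto
      also have "\<dots> = (1 - (real y)\<^sup>2 / real n) * h * (real n - real y)" by simp
      also have "\<dots> \<le> walk_prob (int y) n * (real n - real y)"
        using IH yn by (intro mult_right_mono) auto
      also have "\<dots> = walk_prob (int z) n * (real n + real y + 2)"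
        using walk_prob_step_2[of "int y" n] 3 by (simp add: add.commute)
      finally have "(1 - (real z)\<^sup>2 / real n) * h * (real n + real y + 2) \<le> walk_prob (int z) n * (real n + real y + 2)"
        by (simp add: mult_ac)
      then have "(1 - (real z)\<^sup>2 / real n) * h \<le> walk_prob (int z) n"
        by (rule mult_right_le_imp_le) simp
      then show ?thesis by (simp add: h_def)
    qed
  qed
qed

text \<open>The condition says that \<open>u\<close> is not before the maximum. There \<open>n = u + 1\<close> is at least
  \<open>z\<^sup>2 / 7\<close>, so that the bound \<open>2 z / n\<close> times \<open>1 / \<surd>n\<close> is of order \<open>1 / z\<^sup>2\<close>.\<close>

lemma walk_drop_le:
  assumes "z \<ge> 1" "z\<^sup>2 < 3 * int u + 7"
  shows "walk_drop z u \<le> 42 / (real_of_int z)\<^sup>2"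
proof -
  define r n where "r = real_of_int z" and "n = real (Suc u)"
  have r: "r \<ge> 1" and n: "n \<ge> 1" using assms by (auto simp: r_def n_def)
  have "z\<^sup>2 \<le> 9 * int (Suc u)" using assms by simp
  then have sq: "r\<^sup>2 \<le> 9 * n" unfolding r_def n_def
    by (metis (mono_tags, opaque_lifting) of_int_le_iff of_int_mult of_int_numeral of_int_of_nat_eq of_int_power)
  then have "r\<^sup>2 \<le> (3 * sqrt n)\<^sup>2" using n by (simp add: power_mult_distrib)
  then have r3: "r \<le> 3 * sqrt n" by (rule power2_le_imp_le) (use n in simp)
  have sq7: "r\<^sup>2 \<le> 7 * n"
  proof -
    have "z\<^sup>2 \<le> 7 * int (Suc u)" using assms by simp
    then show ?thesis unfolding r_def n_def
      by (metis (mono_tags, opaque_lifting) of_int_le_iff of_int_mult of_int_numeral of_int_of_nat_eq of_int_power)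
  qed
  have "r * r\<^sup>2 \<le> (3 * sqrt n) * (7 * n)" using sq7 r3 r n by (intro mult_mono) auto
  then have cube: "2 * r * r\<^sup>2 \<le> 42 * (n * sqrt n)" by (simp add: mult_ac)
  have "walk_drop z u \<le> 2 * r / n * (1 / sqrt n)"
    using walk_prob_le[of "Suc u" z] r n unfolding walk_drop_eq r_def n_def
    by (intro mult_left_mono) auto
  also have "\<dots> \<le> 42 / r\<^sup>2" using cube r n by (simp add: field_simps)
  finally show ?thesis by (simp add: r_def)
qed

lemma walk_drop_ge:
  assumes "z \<ge> 1" "even (Suc u + z)" "2 * z\<^sup>2 \<le> Suc u"
  shows "real z / (2 * real (Suc u) * sqrt (real (Suc u))) \<le> walk_drop (int z) u"
proof -
  define n where "n = real (Suc u)"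
  have n: "n \<ge> 1" by (simp add: n_def)
  have "2 * (real z)\<^sup>2 \<le> n"
    using of_nat_mono[OF assms(3), where 'a = real] by (simp add: n_def)
  then have "1 / 2 \<le> 1 - (real z)\<^sup>2 / n" using n by (simp add: field_simps)
  then have "1 / 2 * (1 / (2 * sqrt n)) \<le> (1 - (real z)\<^sup>2 / n) * (1 / (2 * sqrt n))"
    using n by (intro mult_right_mono) auto
  also have "\<dots> \<le> walk_prob (int z) (Suc u)"
    using walk_prob_ge[of "Suc u" z] assms by (simp add: n_def)
  finally have "2 * real z / n * (1 / 2 * (1 / (2 * sqrt n))) \<le> 2 * real z / n * walk_prob (int z) (Suc u)"
    using n by (intro mult_left_mono) auto
  then show ?thesis by (simp add: walk_drop_eq n_def mult_ac del: of_nat_Suc)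
qed

section \<open>The discrepancy as a sum over kicks\<close>

definition kick :: "(int \<Rightarrow> nat) \<Rightarrow> (int \<Rightarrow> int) \<Rightarrow> int \<Rightarrow> nat \<Rightarrow> real" where
  "kick f0 A0 y s = real_of_int (arrow f0 A0 y s) * real (chips f0 A0 y s mod 2)"

text \<open>An arrow turns exactly when its vertex holds an odd number of chips. So the kicks telescope,
  which is how their alternation enters the proof.\<close>

lemma kick_eq_arrow_diff:
  "kick f0 A0 y s = (real_of_int (arrow f0 A0 y s) - real_of_int (arrow f0 A0 y (Suc s))) / 2"
  by (cases "even (chips f0 A0 y s)") (auto simp: kick_def mod_2_eq_odd)

lemma sum_kick_le_1:
  assumes "valid_arrows A0"
  shows "\<bar>\<Sum>s\<in>{p..<q}. kick f0 A0 y s\<bar> \<le> 1"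
proof (cases "p \<le> q")
  case True
  then have "(\<Sum>s\<in>{p..<q}. kick f0 A0 y s) =
      (real_of_int (arrow f0 A0 y p) - real_of_int (arrow f0 A0 y q)) / 2"
    by (induction q rule: dec_induct) (simp_all only: sum.atLeastLessThan_Suc kick_eq_arrow_diff, simp_all add: field_simps)
  then show ?thesis
    using arrow_range[OF assms, of f0 y p] arrow_range[OF assms, of f0 y q] by auto
qed simp

lemma even_config_chips_parity:
  assumes "even_config f0" "odd (y + int s)"
  shows "chips f0 A0 y s = 0"
  using assms(2)
proof (induction s arbitrary: y)
  case 0
  then show ?case using assms(1) by (simp add: even_config_def)
next
  case (Suc s)
  then have "chips f0 A0 (y - 1) s = 0" "chips f0 A0 (y + 1) s = 0" by auto
  then show ?case by simp
qed

lemma odd_config_chips_parity: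
  assumes "odd_config f0" "even (y + int s)"
  shows "chips f0 A0 y s = 0"
  using assms(2)
proof (induction s arbitrary: y)
  case 0
  then show ?case using assms(1) by (simp add: odd_config_def)
next
  case (Suc s)
  then have "chips f0 A0 (y - 1) s = 0" "chips f0 A0 (y + 1) s = 0" by auto
  then show ?case by simp
qed

text \<open>Each vertex is occupied, and hence kicks, only at times of one parity.\<close>

lemma kick_parity:
  assumes "even_config f0 \<or> odd_config f0"
  obtains e where "\<And>s. even s \<noteq> e \<Longrightarrow> kick f0 A0 y s = 0"
proof (cases "even_config f0")
  case True
  show ?thesis
  proof (rule that)
    fix s :: nat assume "even s \<noteq> even y"
    then have "chips f0 A0 y s = 0" by (intro even_config_chips_parity True) auto
    then show "kick f0 A0 y s = 0" by (simp add: kick_def)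
  qed
next
  case False
  then have odd: "odd_config f0" using assms by simp
  show ?thesis
  proof (rule that)
    fix s :: nat assume "even s \<noteq> odd y"
    then have "chips f0 A0 y s = 0" by (intro odd_config_chips_parity odd) auto
    then show "kick f0 A0 y s = 0" by (simp add: kick_def)
  qed
qed

lemma expected_chips_window:
  assumes "\<bar>x\<bar> + int t \<le> N"
  shows "expected_chips f0 x t = (\<Sum>y\<in>{-N..N}. real (f0 y) * walk_prob (x - y) t)"
  unfolding expected_chips_finite_sum
  using assms by (intro sum.mono_neutral_left) (auto simp: walk_prob_eq_0)

text \<open>Both sides satisfy the recursion of the random walk, with the same error term: a kick at
  \<open>(y, t)\<close> adds \<open>1/2\<close> at \<open>y + 1\<close> and subtracts \<open>1/2\<close> at \<open>y - 1\<close>, and these are the values of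
  \<open>walk_drop (x - y) 0 / 2\<close>.\<close>

lemma discrepancy_at:
  assumes "valid_arrows A0" "\<bar>x\<bar> + int t \<le> N"
  shows "real (chips f0 A0 x t) - expected_chips f0 x t =
    (\<Sum>s<t. \<Sum>y\<in>{-N..N}. kick f0 A0 y s * walk_drop (x - y) (t - Suc s)) / 2"
  using assms(2)
proof (induction t arbitrary: x)
  case 0
  have "expected_chips f0 x 0 = (\<Sum>y\<in>{-N..N}. if x = y then real (f0 y) else 0)"
    unfolding expected_chips_window[OF 0] by (intro sum.cong) (auto simp: walk_prob_0)
  also have "\<dots> = real (f0 x)" using 0 by (auto simp: abs_le_iff)
  finally show ?case by simp
next
  case (Suc t)
  define D where "D = (\<lambda>x. \<Sum>s<t. \<Sum>y\<in>{-N..N}. kick f0 A0 y s * walk_drop (x - y) (t - Suc s))"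
  let ?S = "\<lambda>x. \<Sum>y\<in>{-N..N}. real (f0 y) * walk_prob (x - y) t"
  have N: "\<bar>x - 1\<bar> + int t \<le> N" "\<bar>x + 1\<bar> + int t \<le> N" using Suc.prems by auto
  have IH: "real (chips f0 A0 (x - 1) t) = expected_chips f0 (x - 1) t + D (x - 1) / 2"
    "real (chips f0 A0 (x + 1) t) = expected_chips f0 (x + 1) t + D (x + 1) / 2"
    using Suc.IH[OF N(1)] Suc.IH[OF N(2)] by (simp_all add: D_def)
  have E: "expected_chips f0 x (Suc t) = (expected_chips f0 (x - 1) t + expected_chips f0 (x + 1) t) / 2"
    unfolding expected_chips_window[OF N(1)] expected_chips_window[OF N(2)]
      expected_chips_window[OF Suc.prems] sum.distrib[symmetric] sum_divide_distrib
    by (intro sum.cong refl) (simp add: walk_prob_Suc algebra_simps)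
  have drop_Suc: "walk_drop (x - y) (Suc t - Suc s) =
      (walk_drop (x - 1 - y) (t - Suc s) + walk_drop (x + 1 - y) (t - Suc s)) / 2" if "s < t" for s y
  proof -
    have "Suc t - Suc s = Suc (t - Suc s)" using that by simp
    then show ?thesis by (simp only:) (simp add: walk_drop_def walk_prob_Suc field_simps)
  qed
  have "(\<Sum>y\<in>{-N..N}. kick f0 A0 y t * walk_drop (x - y) 0) =
      (\<Sum>y\<in>{-N..N}. (if y = x - 1 then kick f0 A0 y t else 0) - (if y = x + 1 then kick f0 A0 y t else 0))"
    by (intro sum.cong) (auto simp: walk_drop_def walk_prob_0)
  also have "\<dots> = kick f0 A0 (x - 1) t - kick f0 A0 (x + 1) t"
  proof -
    have "- N \<le> x - 1" "x + 1 \<le> N" using Suc.prems by linarith+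
    then show ?thesis by (simp add: sum_subtractf)
  qed
  finally have last: "(\<Sum>y\<in>{-N..N}. kick f0 A0 y t * walk_drop (x - y) 0) =
      kick f0 A0 (x - 1) t - kick f0 A0 (x + 1) t" .
  have "(\<Sum>s<Suc t. \<Sum>y\<in>{-N..N}. kick f0 A0 y s * walk_drop (x - y) (Suc t - Suc s)) =
      (D (x - 1) + D (x + 1)) / 2 + (kick f0 A0 (x - 1) t - kick f0 A0 (x + 1) t)"
  proof -
    have "(\<Sum>s<t. \<Sum>y\<in>{-N..N}. kick f0 A0 y s * walk_drop (x - y) (Suc t - Suc s)) =
        (D (x - 1) + D (x + 1)) / 2"
      unfolding D_def sum.distrib[symmetric] sum_divide_distrib
      by (intro sum.cong refl, subst drop_Suc) (auto simp: algebra_simps)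
    then show ?thesis using last by simp
  qed
  moreover have "real (chips f0 A0 x (Suc t)) =
      (real (chips f0 A0 (x - 1) t) + real (chips f0 A0 (x + 1) t)) / 2
      + (kick f0 A0 (x - 1) t - kick f0 A0 (x + 1) t) / 2"
    unfolding chips_Suc[OF assms(1)] kick_def by (simp add: field_simps)
  ultimately show ?case unfolding E IH by (simp add: field_simps)
qed

text \<open>Twice the contribution of the kicks at \<open>y\<close> to the discrepancy on \<open>{y + z} \<times> S\<close>.\<close>

definition influence :: "(int \<Rightarrow> nat) \<Rightarrow> (int \<Rightarrow> int) \<Rightarrow> nat set \<Rightarrow> int \<Rightarrow> int \<Rightarrow> real" where
  "influence f0 A0 S y z = (\<Sum>t\<in>S. \<Sum>s<t. kick f0 A0 y s * walk_drop z (t - Suc s))"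

lemma influence_minus: "influence f0 A0 S y (- z) = - influence f0 A0 S y z"
  by (simp add: influence_def walk_drop_minus sum_negf)

lemma discrepancy_on:
  assumes "valid_arrows A0" "\<And>x t. x \<in> X \<Longrightarrow> t \<in> S \<Longrightarrow> \<bar>x\<bar> + int t \<le> N"
  shows "real (chips_on f0 A0 X S) - expected_on f0 X S =
    (\<Sum>y\<in>{-N..N}. \<Sum>x\<in>X. influence f0 A0 S y (x - y)) / 2"
proof -
  have "real (chips_on f0 A0 X S) - expected_on f0 X S =
     (\<Sum>x\<in>X. \<Sum>t\<in>S. real (chips f0 A0 x t) - expected_chips f0 x t)"
    by (simp add: chips_on_def expected_on_def sum_subtractf)
  also have "\<dots> = (\<Sum>x\<in>X. \<Sum>t\<in>S. (\<Sum>y\<in>{-N..N}. \<Sum>s<t. kick f0 A0 y s * walk_drop (x - y) (t - Suc s)) / 2)"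
    using assms by (intro sum.cong refl) (simp add: discrepancy_at[of A0 _ _ N] sum.swap[of _ "{-N..N}"])
  also have "\<dots> = (\<Sum>x\<in>X. \<Sum>y\<in>{-N..N}. influence f0 A0 S y (x - y)) / 2"
    unfolding influence_def sum.swap[of _ "{-N..N}" S] sum_divide_distrib ..
  also have "(\<Sum>x\<in>X. \<Sum>y\<in>{-N..N}. influence f0 A0 S y (x - y)) = (\<Sum>y\<in>{-N..N}. \<Sum>x\<in>X. influence f0 A0 S y (x - y))"
    by (rule sum.swap)
  finally show ?thesis .
qed

section \<open>Bounds for the influence of one vertex\<close>

text \<open>Summation by parts bounds the sum by \<open>w 0\<close> plus the total variation of \<open>w\<close>, which is at most
  twice the maximum \<open>w m\<close>.\<close>

lemma alternating_sum_le:
  fixes a w :: "nat \<Rightarrow> real"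
  assumes a: "\<And>p q. \<bar>\<Sum>u\<in>{p..<q}. a u\<bar> \<le> 1"
    and up: "\<And>u. u < m \<Longrightarrow> w u \<le> w (Suc u)"
    and down: "\<And>u. u \<ge> m \<Longrightarrow> w (Suc u) \<le> w u"
    and nonneg: "\<And>u. w u \<ge> 0"
  shows "\<bar>\<Sum>u<n. a u * w u\<bar> \<le> 2 * w m"
proof -
  \<comment> \<open>Freezing the weight at \<open>w n\<close> from \<open>n\<close> on makes the summation by parts an induction; the
    right-hand side is the bound \<open>w 0\<close> plus the variation of \<open>w\<close> up to \<open>n\<close> for unimodal \<open>w\<close>.\<close>
  have "\<bar>(\<Sum>u<n. a u * w u) + w n * (\<Sum>u\<in>{n..<q}. a u)\<bar> \<le> (if n \<le> m then w n else 2 * w m - w n)"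
    if "n \<le> q" for n q
    using that
  proof (induction n)
    case 0
    have "w 0 * \<bar>\<Sum>u\<in>{0..<q}. a u\<bar> \<le> w 0 * 1" using a nonneg by (intro mult_left_mono)
    then show ?case using nonneg[of 0] by (simp add: abs_mult)
  next
    case (Suc n)
    let ?A = "\<Sum>u\<in>{Suc n..<q}. a u"
    have "(\<Sum>u\<in>{n..<q}. a u) = a n + ?A" using Suc.prems by (simp add: sum.atLeast_Suc_lessThan)
    then have "(\<Sum>u<Suc n. a u * w u) + w (Suc n) * ?A =
        ((\<Sum>u<n. a u * w u) + w n * (\<Sum>u\<in>{n..<q}. a u)) + (w (Suc n) - w n) * ?A"
      by (simp add: algebra_simps)
    moreover have "\<bar>(w (Suc n) - w n) * ?A\<bar> \<le> \<bar>w (Suc n) - w n\<bar>"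
      unfolding abs_mult using a[of "Suc n" q] by (intro mult_left_le) auto
    moreover have "\<bar>(\<Sum>u<n. a u * w u) + w n * (\<Sum>u\<in>{n..<q}. a u)\<bar> \<le> (if n \<le> m then w n else 2 * w m - w n)"
      using Suc by simp
    ultimately have "\<bar>(\<Sum>u<Suc n. a u * w u) + w (Suc n) * ?A\<bar>
        \<le> (if n \<le> m then w n else 2 * w m - w n) + \<bar>w (Suc n) - w n\<bar>" by linarith
    also have "\<dots> \<le> (if Suc n \<le> m then w (Suc n) else 2 * w m - w (Suc n))"
      using up[of n] down[of n] by (cases "n = m"; cases "n < m") auto
    finally show ?case .
  qed
  from this[of n n] have "\<bar>\<Sum>u<n. a u * w u\<bar> \<le> (if n \<le> m then w n else 2 * w m - w n)" by simp
  also have "\<dots> \<le> 2 * w m"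
  proof (cases "n \<le> m")
    case True
    then have "w n \<le> w m" by (induction n rule: inc_induct) (use up in \<open>auto intro: order_trans\<close>)
    then show ?thesis using True nonneg[of m] by simp
  next
    case False
    then show ?thesis using nonneg[of n] by simp
  qed
  finally show ?thesis .
qed

text \<open>This is where the configuration must be even or odd: \<open>walk_drop z\<close> is unimodal only along times
  of one parity, and so the kicks must occur at times of one parity.\<close>

lemma kick_influence_le:
  assumes "valid_arrows A0" "even_config f0 \<or> odd_config f0" "z \<ge> 1"
  shows "\<bar>\<Sum>s<t. kick f0 A0 y s * walk_drop z (t - Suc s)\<bar> \<le> 168 / (real_of_int z)\<^sup>2"
proof -
  obtain e where e: "\<And>s. even s \<noteq> e \<Longrightarrow> kick f0 A0 y s = 0" using kick_parity[OF assms(2)] by metis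
  \<comment> \<open>\<open>w\<close> agrees with \<open>walk_drop z\<close> at the times where that does not vanish, and fills the
    gaps between them so that \<open>w\<close> is unimodal in single steps.\<close>
  define a where "a = (\<lambda>u. if u < t then kick f0 A0 y (t - Suc u) else 0)"
  define w where "w = (\<lambda>u. walk_drop z u + walk_drop z (Suc u))"
  define m where "m = (LEAST u. z\<^sup>2 < 3 * int u + 7)"
  have ex: "z\<^sup>2 < 3 * int (nat (z\<^sup>2)) + 7" by (simp add: add_nonneg_pos)
  have m: "z\<^sup>2 < 3 * int m + 7" unfolding m_def by (rule LeastI[of _ "nat (z\<^sup>2)"]) (rule ex)
  have below_m: "3 * int u + 7 \<le> z\<^sup>2" if "u < m" for u
    using not_less_Least[of u "\<lambda>u. z\<^sup>2 < 3 * int u + 7"] that by (simp add: m_def)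
  have bound: "\<bar>\<Sum>u<t. a u * w u\<bar> \<le> 2 * w m" if a1: "\<And>p q. \<bar>\<Sum>u\<in>{p..<q}. a u\<bar> \<le> 1"
  proof (rule alternating_sum_le)
    show "w u \<le> w (Suc u)" if "u < m" for u
      using walk_drop_increasing[of z u] below_m[OF that] assms by (simp add: w_def)
    show "w (Suc u) \<le> w u" if "m \<le> u" for u
      using walk_drop_decreasing[of z u] m that assms by (simp add: w_def)
    show "0 \<le> w u" for u using assms by (simp add: w_def walk_drop_nonneg)
  qed (rule a1)
  have "\<bar>\<Sum>u\<in>{p..<q}. a u\<bar> \<le> 1" for p q
  proof -
    have "(\<Sum>u\<in>{p..<q}. a u) = (\<Sum>u\<in>{p..<min q t}. kick f0 A0 y (t - Suc u))"
      unfolding a_def by (rule sum.mono_neutral_cong_right) auto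
    also have "\<dots> = (\<Sum>s\<in>{t - min q t..<t - p}. kick f0 A0 y s)"
      by (rule sum.reindex_bij_witness[of _ "\<lambda>s. t - Suc s" "\<lambda>u. t - Suc u"]) auto
    finally show ?thesis using sum_kick_le_1[OF assms(1)] by simp
  qed
  from bound[OF this] have *: "\<bar>\<Sum>u<t. a u * w u\<bar> \<le> 2 * w m" .
  have wm: "w m \<le> 84 / (real_of_int z)\<^sup>2"
    using walk_drop_le[of z m] walk_drop_le[of z "Suc m"] m assms by (simp add: w_def)
  have rev: "(\<Sum>s<t. kick f0 A0 y s * walk_drop z (t - Suc s)) = (\<Sum>u<t. a u * walk_drop z u)"
    by (subst sum.nat_diff_reindex[symmetric]) (auto intro!: sum.cong simp: a_def)
  show ?thesis
  proof (cases "even (int t + z) = e")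
    case True
    \<comment> \<open>The kicks occur at the times at which \<open>walk_drop z\<close> need not vanish, and there the extra
      summand of \<open>w\<close> is \<open>0\<close>.\<close>
    have "a u * walk_drop z u = a u * w u" for u
    proof (cases "a u = 0")
      case False
      then have "u < t" "even (t - Suc u) = e" using e[of "t - Suc u"] by (auto simp: a_def split: if_splits)
      then have "even (int (Suc u) - z)" using True by auto
      then show ?thesis using walk_drop_eq_0[of "Suc u" z] by (simp add: w_def)
    qed simp
    then have "(\<Sum>u<t. a u * walk_drop z u) = (\<Sum>u<t. a u * w u)" by (intro sum.cong refl)
    then show ?thesis using * wm rev by simp
  next
    case False
    have "a u * walk_drop z u = 0" for u
    proof (cases "a u = 0")
      case nz: False
      then have "u < t" "even (t - Suc u) = e" using e[of "t - Suc u"] by (auto simp: a_def split: if_splits)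
      then have "even (int u - z)" using False by auto
      then show ?thesis using walk_drop_eq_0[of u z] by simp
    qed simp
    then have "(\<Sum>u<t. a u * walk_drop z u) = 0" by (intro sum.neutral ballI)
    then show ?thesis using rev by simp
  qed
qed

lemma influence_le_decay:
  assumes "valid_arrows A0" "even_config f0 \<or> odd_config f0" "z \<ge> 1" "card S = T"
  shows "\<bar>influence f0 A0 S y z\<bar> \<le> 168 * real T / (real_of_int z)\<^sup>2"
proof -
  have "\<bar>influence f0 A0 S y z\<bar> \<le> (\<Sum>t\<in>S. 168 / (real_of_int z)\<^sup>2)"
    unfolding influence_def by (rule order_trans[OF sum_abs sum_mono[OF kick_influence_le]]) (use assms in auto)
  then show ?thesis using assms by (simp add: mult.commute)
qed

text \<open>Collecting the terms with the same age \<open>u = t - s - 1\<close> leaves, for each \<open>u\<close>, a sum of kicks over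
  an interval of times, which is at most \<open>1\<close>.\<close>

lemma influence_le_4:
  assumes "valid_arrows A0" "z \<ge> 0" "S = {t0..<t0 + T}"
  shows "\<bar>influence f0 A0 S y z\<bar> \<le> 4"
proof -
  let ?M = "t0 + T"
  have "influence f0 A0 S y z = (\<Sum>t\<in>S. \<Sum>u<?M. if u < t then kick f0 A0 y (t - Suc u) * walk_drop z u else 0)"
    unfolding influence_def
  proof (rule sum.cong[OF refl])
    fix t assume "t \<in> S"
    have "(\<Sum>s<t. kick f0 A0 y s * walk_drop z (t - Suc s)) = (\<Sum>u<t. kick f0 A0 y (t - Suc u) * walk_drop z u)"
      by (subst sum.nat_diff_reindex[symmetric]) (auto intro!: sum.cong)
    also have "\<dots> = (\<Sum>u<?M. if u < t then kick f0 A0 y (t - Suc u) * walk_drop z u else 0)"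
      using \<open>t \<in> S\<close> assms by (intro sum.mono_neutral_cong_left) auto
    finally show "(\<Sum>s<t. kick f0 A0 y s * walk_drop z (t - Suc s)) = \<dots>" .
  qed
  also have "\<dots> = (\<Sum>u<?M. walk_drop z u * (\<Sum>t\<in>{max t0 (Suc u)..<?M}. kick f0 A0 y (t - Suc u)))"
    unfolding sum_distrib_left
    by (subst sum.swap, intro sum.cong refl sum.mono_neutral_cong_right) (auto simp: assms)
  also have "\<bar>\<dots>\<bar> \<le> (\<Sum>u<?M. walk_drop z u)"
  proof (rule order_trans[OF sum_abs sum_mono])
    fix u assume "u \<in> {..<?M}"
    have "(\<Sum>t\<in>{max t0 (Suc u)..<?M}. kick f0 A0 y (t - Suc u)) =
        (\<Sum>s\<in>{max t0 (Suc u) - Suc u..<?M - Suc u}. kick f0 A0 y s)"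
      by (rule sum.reindex_bij_witness[of _ "\<lambda>s. s + Suc u" "\<lambda>t. t - Suc u"]) auto
    then have "\<bar>\<Sum>t\<in>{max t0 (Suc u)..<?M}. kick f0 A0 y (t - Suc u)\<bar> \<le> 1"
      using sum_kick_le_1[OF assms(1)] by simp
    then show "\<bar>walk_drop z u * (\<Sum>t\<in>{max t0 (Suc u)..<?M}. kick f0 A0 y (t - Suc u))\<bar> \<le> walk_drop z u"
      using walk_drop_nonneg[OF assms(2), of u] by (simp add: abs_mult mult_left_le)
  qed
  also have "\<dots> \<le> 4" using sum_walk_drop_le[OF assms(2)] by simp
  finally show ?thesis .
qed

section \<open>The upper bound in terms of distances\<close>

lemma sum_odd_function:
  fixes I :: "int \<Rightarrow> real"
  assumes odd: "\<And>w. I (- w) = - I w" and M: "\<And>x. x \<in> X \<Longrightarrow> \<bar>x - y\<bar> \<le> int M"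
  shows "(\<Sum>x\<in>X. I (x - y)) =
    (\<Sum>z\<in>{1..M}. (of_bool (y + int z \<in> X) - of_bool (y - int z \<in> X)) * I (int z))"
proof -
  define g where "g = (\<lambda>w. of_bool (y + w \<in> X) * I w)"
  have I0: "I 0 = 0" using odd[of 0] by simp
  have "(\<Sum>x\<in>X. I (x - y)) = (\<Sum>w\<in>(\<lambda>x. x - y) ` X. g w)"
    by (subst sum.reindex) (auto simp: inj_on_def g_def)
  also have "\<dots> = (\<Sum>w\<in>{- int M..int M} - {0}. g w)"
  proof (rule sum.mono_neutral_cong)
    show "finite ((\<lambda>x. x - y) ` X)"
      by (rule finite_subset[of _ "{- int M..int M}"]) (use M in \<open>force simp: abs_le_iff\<close>)+
    show "g i = 0" if "i \<in> {- int M..int M} - {0} - (\<lambda>x. x - y) ` X" for i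
    proof -
      have "y + i \<notin> X"
      proof
        assume "y + i \<in> X"
        from imageI[OF this, of "\<lambda>x. x - y"] show False using that by simp
      qed
      then show ?thesis by (simp add: g_def)
    qed
    show "g i = 0" if "i \<in> (\<lambda>x. x - y) ` X - ({- int M..int M} - {0})" for i
    proof -
      have "i = 0" using that M by (force simp: abs_le_iff)
      then show ?thesis by (simp add: g_def I0)
    qed
  qed auto
  also have "{- int M..int M} - {0} = int ` {1..M} \<union> (\<lambda>z. - int z) ` {1..M}"
  proof -
    have "(\<lambda>z. - int z) ` {1..M} = uminus ` (int ` {1..M})" by (simp only: image_image)
    also have "\<dots> = {- int M..- 1}" by (simp add: image_int_atLeastAtMost)
    finally show ?thesis by (auto simp: image_int_atLeastAtMost)
  qed
  also have "(\<Sum>w\<in>\<dots>. g w) = (\<Sum>w\<in>int ` {1..M}. g w) + (\<Sum>w\<in>(\<lambda>z. - int z) ` {1..M}. g w)"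
    by (rule sum.union_disjoint) auto
  also have "\<dots> = (\<Sum>z\<in>{1..M}. g (int z) + g (- int z))"
    by (simp add: sum.reindex inj_on_def sum.distrib)
  also have "\<dots> = (\<Sum>z\<in>{1..M}. (of_bool (y + int z \<in> X) - of_bool (y - int z \<in> X)) * I (int z))"
    by (intro sum.cong refl) (simp add: g_def odd algebra_simps)
  finally show ?thesis .
qed

text \<open>The interval \<open>X\<close> shifted by \<open>z\<close> and by \<open>- z\<close>: the symmetric difference is contained in the union
  of the two, and also consists of points within distance \<open>z\<close> of one of the two ends of \<open>X\<close>.\<close>

lemma card_unbalanced_le:
  fixes X :: "int set"
  assumes "X = {a..<a + int L}" "finite Y"
  shows "card {y \<in> Y. (y + int z \<in> X) \<noteq> (y - int z \<in> X)} \<le> min (2 * L) (4 * z)"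
proof -
  let ?B = "{y \<in> Y. (y + int z \<in> X) \<noteq> (y - int z \<in> X)}"
  have "?B \<subseteq> {a - int z..<a - int z + int L} \<union> {a + int z..<a + int z + int L}"
    using assms by auto
  then have "card ?B \<le> card ({a - int z..<a - int z + int L} \<union> {a + int z..<a + int z + int L})"
    by (intro card_mono) auto
  also have "\<dots> \<le> 2 * L"
    by (rule order_trans[OF card_Un_le]) simp
  finally have 1: "card ?B \<le> 2 * L" .
  have "?B \<subseteq> {a - int z..<a + int z} \<union> {a + int L - int z..<a + int L + int z}"
    using assms by auto
  then have "card ?B \<le> card ({a - int z..<a + int z} \<union> {a + int L - int z..<a + int L + int z})"
    by (intro card_mono) auto
  also have "\<dots> \<le> 4 * z"
    by (rule order_trans[OF card_Un_le]) simp
  finally show ?thesis using 1 by simp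
qed

text \<open>Half the number of vertices \<open>y\<close> for which \<open>y + z\<close> and \<open>y - z\<close> do not cancel, at most, times
  the bound for the influence of each.\<close>

definition discrepancy_weight :: "nat \<Rightarrow> nat \<Rightarrow> nat \<Rightarrow> real" where
  "discrepancy_weight L T z = real (min L (2 * z)) * min 4 (168 * real T / (real z)\<^sup>2)"

lemma discrepancy_on_le:
  assumes valid: "valid_arrows A0" and parity: "even_config f0 \<or> odd_config f0"
    and X: "int_interval L X" and S: "nat_interval T S"
  shows "\<exists>M. \<bar>real (chips_on f0 A0 X S) - expected_on f0 X S\<bar> \<le> (\<Sum>z\<in>{1..M}. discrepancy_weight L T z)"
proof -
  obtain a where a: "X = {a..<a + int L}" using X by (auto simp: int_interval_def)
  obtain t0 where t0: "S = {t0..<t0 + T}" using S by (auto simp: nat_interval_def)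
  define N M where "N = \<bar>a\<bar> + int L + int t0 + int T" and "M = nat (2 * N)"
  have M: "int M = 2 * N" by (simp add: M_def N_def)
  have "real (chips_on f0 A0 X S) - expected_on f0 X S =
      (\<Sum>y\<in>{-N..N}. \<Sum>x\<in>X. influence f0 A0 S y (x - y)) / 2"
    by (rule discrepancy_on[OF valid]) (auto simp: a t0 N_def)
  also have "\<dots> = (\<Sum>y\<in>{-N..N}. \<Sum>z\<in>{1..M}. (of_bool (y + int z \<in> X) - of_bool (y - int z \<in> X)) *
      influence f0 A0 S y (int z)) / 2"
    by (intro arg_cong[of _ _ "\<lambda>r. r / 2"] sum.cong refl sum_odd_function influence_minus)
      (auto simp: M a N_def)
  finally have eq: "real (chips_on f0 A0 X S) - expected_on f0 X S =
      (\<Sum>y\<in>{-N..N}. \<Sum>z\<in>{1..M}. (of_bool (y + int z \<in> X) - of_bool (y - int z \<in> X)) *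
      influence f0 A0 S y (int z)) / 2" .
  let ?b = "\<lambda>z. min 4 (168 * real T / (real z)\<^sup>2)"
  have "\<bar>\<Sum>y\<in>{-N..N}. \<Sum>z\<in>{1..M}. (of_bool (y + int z \<in> X) - of_bool (y - int z \<in> X)) *
      influence f0 A0 S y (int z)\<bar> \<le>
      (\<Sum>y\<in>{-N..N}. \<Sum>z\<in>{1..M}. of_bool ((y + int z \<in> X) \<noteq> (y - int z \<in> X)) * ?b z)"
  proof (intro order_trans[OF sum_abs sum_mono])
    fix y z assume "z \<in> {1..M}"
    then have "\<bar>influence f0 A0 S y (int z)\<bar> \<le> ?b z"
      using influence_le_4[OF valid _ t0, of "int z" f0 y]
        influence_le_decay[OF valid parity, of "int z" S T y] t0 by simp
    then show "\<bar>(of_bool (y + int z \<in> X) - of_bool (y - int z \<in> X)) * influence f0 A0 S y (int z)\<bar>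
        \<le> of_bool ((y + int z \<in> X) \<noteq> (y - int z \<in> X)) * ?b z"
      by (auto simp: abs_mult)
  qed
  also have "\<dots> = (\<Sum>z\<in>{1..M}. real (card {y \<in> {-N..N}. (y + int z \<in> X) \<noteq> (y - int z \<in> X)}) * ?b z)"
    by (subst sum.swap) (simp add: sum_distrib_right[symmetric] Int_def)
  also have "\<dots> \<le> (\<Sum>z\<in>{1..M}. real (min (2 * L) (4 * z)) * ?b z)"
    using card_unbalanced_le[OF a] by (intro sum_mono mult_right_mono) (auto simp only: of_nat_le_iff finite_atLeastAtMost_int, auto)
  also have "\<dots> = 2 * (\<Sum>z\<in>{1..M}. discrepancy_weight L T z)"
    unfolding sum_distrib_left discrepancy_weight_def
    by (intro sum.cong refl) (auto simp: min_def)
  finally show ?thesis unfolding eq by (intro exI[of _ M]) simp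
qed

lemma max_discrepancy_le:
  assumes "\<And>M. (\<Sum>z\<in>{1..M}. discrepancy_weight L T z) \<le> B"
  shows "max_discrepancy L T \<le> ereal B"
  unfolding max_discrepancy_def
proof (rule Sup_least, clarify)
  fix f0 A0 X S
  assume "valid_arrows A0" "even_config f0 \<or> odd_config f0" "int_interval L X" "nat_interval T S"
  then obtain M where
    "\<bar>real (chips_on f0 A0 X S) - expected_on f0 X S\<bar> \<le> (\<Sum>z\<in>{1..M}. discrepancy_weight L T z)"
    using discrepancy_on_le by blast
  also have "\<dots> \<le> B" by (rule assms)
  finally show "ereal \<bar>real (chips_on f0 A0 X S) - expected_on f0 X S\<bar> \<le> ereal B" by simp
qed

section \<open>Forcing arbitrary parities\<close>

text \<open>Chips that split evenly and double at each step: \<open>2\<^sup>t\<close> times the expected number of chips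
  after \<open>t\<close> steps of the walk.\<close>

fun spread :: "(int \<Rightarrow> nat) \<Rightarrow> int \<Rightarrow> nat \<Rightarrow> nat" where
  "spread g x 0 = g x"
| "spread g x (Suc t) = spread g (x - 1) t + spread g (x + 1) t"

text \<open>Piles of \<open>2\<^sup>t\<close> chips split evenly for \<open>t\<close> steps, so they move like the random walk and do not
  disturb the other chips or the arrows. They change parities at time \<open>t\<close>, but not before.\<close>

lemma chips_add_multiple:
  assumes "valid_arrows A0" "s \<le> t"
  shows "chips (\<lambda>x. f0 x + 2 ^ t * g x) A0 y s = chips f0 A0 y s + 2 ^ (t - s) * spread g y s \<and>
    arrow (\<lambda>x. f0 x + 2 ^ t * g x) A0 y s = arrow f0 A0 y s"
proof -
  define f where "f = (\<lambda>x. f0 x + 2 ^ t * g x)"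
  have "chips f A0 y s = chips f0 A0 y s + 2 ^ (t - s) * spread g y s \<and> arrow f A0 y s = arrow f0 A0 y s"
    using assms(2)
  proof (induction s arbitrary: y)
    case 0
    then show ?case by (simp add: f_def)
  next
    case (Suc s)
    define K :: nat where "K = 2 ^ (t - Suc s)"
    have "t - s = Suc (t - Suc s)" using Suc.prems by simp
    then have K: "2 ^ (t - s) = 2 * K" by (simp add: K_def)
    have IH: "chips f A0 z s = chips f0 A0 z s + 2 * (K * spread g z s)"
      "arrow f A0 z s = arrow f0 A0 z s" for z
      using Suc by (simp_all add: K)
    have "chips f A0 z s mod 2 = chips f0 A0 z s mod 2" for z
      by (simp add: IH)
    then have "real (chips f A0 y (Suc s)) = real (chips f0 A0 y (Suc s) + K * spread g y (Suc s))"
      unfolding chips_Suc[OF assms(1)] of_nat_add of_nat_mult by (simp add: IH algebra_simps)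
    then have "chips f A0 y (Suc s) = chips f0 A0 y (Suc s) + K * spread g y (Suc s)"
      by (simp only: of_nat_eq_iff)
    moreover have "arrow f A0 y (Suc s) = arrow f0 A0 y (Suc s)"
      by (simp add: IH power_add power_mult)
    ultimately show ?case by (simp only: K_def)
  qed
  then show ?thesis by (simp only: f_def)
qed

text \<open>Modulo \<open>2\<close>, one step backwards means solving \<open>h (y - 1) + h (y + 1) = q y\<close> on \<open>\<int>\<close>. Starting
  from \<open>h 0 = h (- 1) = 0\<close>, this determines \<open>h\<close> in both directions.\<close>

lemma spread_parity_surj:
  assumes "\<And>y. q y \<Longrightarrow> even (y + int t)"
  obtains g where "\<And>y. odd y \<Longrightarrow> g y = 0" "\<And>y. odd (spread g y t) \<longleftrightarrow> q y"
  using assms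
proof (induction t arbitrary: q thesis)
  case 0
  show ?case
    by (rule 0(1)[of "\<lambda>y. if q y then 1 else 0"]) (use 0(2) in auto)
next
  case (Suc t)
  \<comment> \<open>The solution is the parity of \<open>card (H y)\<close>: unrolling the recursion between \<open>0\<close> and \<open>y\<close> collects
    the values of \<open>q\<close> at every other place.\<close>
  define H where "H = (\<lambda>y. {x. (0 \<le> x \<and> x < y \<or> y < x \<and> x < 0) \<and> q x \<and> odd (x + y)})"
  have fin: "finite (H y)" for y
    by (rule finite_subset[of _ "{- \<bar>y\<bar>..\<bar>y\<bar>}"]) (auto simp: H_def)
  have "even (y + int t)" if "odd (card (H y))" for y
  proof -
    have "H y \<noteq> {}" using that by (metis card.empty even_zero)
    then obtain x where "q x" "odd (x + y)" by (auto simp: H_def)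
    then show ?thesis using Suc.prems(2)[of x] by auto
  qed
  then obtain g where g: "\<And>y. odd y \<Longrightarrow> g y = 0" "\<And>y. odd (spread g y t) \<longleftrightarrow> odd (card (H y))"
    using Suc.IH[of "\<lambda>y. odd (card (H y))"] by metis
  have "odd (card (H (y - 1)) + card (H (y + 1))) \<longleftrightarrow> q y" for y
  proof -
    \<comment> \<open>Of the two sets, \<open>B\<close> belongs to the neighbour of \<open>y\<close> further away from the origin.\<close>
    define A B where "A = (if y \<ge> 0 then H (y - 1) else H (y + 1))"
      and "B = (if y \<ge> 0 then H (y + 1) else H (y - 1))"
    have yA: "y \<notin> A" by (auto simp: A_def H_def)
    have "B = (if q y then insert y A else A)"
    proof (rule set_eqI)
      fix x
      consider "x = y" | "x = y - 1" | "x = y + 1" | "x < y - 1" | "x > y + 1" by linarith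
      then show "x \<in> B \<longleftrightarrow> x \<in> (if q y then insert y A else A)"
        by cases (auto simp: A_def B_def H_def)
    qed
    moreover have "finite A" using fin by (simp add: A_def)
    ultimately have "card B = (if q y then Suc (card A) else card A)" using yA by simp
    moreover have "card (H (y - 1)) + card (H (y + 1)) = card A + card B"
      by (simp add: A_def B_def)
    ultimately show ?thesis by auto
  qed
  then show ?case using g by (intro Suc.prems(1)[of g]) auto
qed

text \<open>The parities are corrected one time after the other: those at time \<open>t\<close> by adding piles of
  \<open>2\<^sup>t\<close> chips, which leaves the earlier ones intact.\<close>

lemma parity_forcing:
  assumes "valid_arrows A0" "\<And>y s. P y s \<Longrightarrow> even (y + int s)"
  obtains f0 where "even_config f0" "\<And>y s. s < t \<Longrightarrow> odd (chips f0 A0 y s) \<longleftrightarrow> P y s"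
proof (induction t arbitrary: thesis)
  case 0
  show ?case by (rule 0[of "\<lambda>_. 0"]) (auto simp: even_config_def)
next
  case (Suc t)
  obtain f0 where f0: "even_config f0" "\<And>y s. s < t \<Longrightarrow> odd (chips f0 A0 y s) \<longleftrightarrow> P y s"
    using Suc.IH by metis
  define q where "q = (\<lambda>y. odd (chips f0 A0 y t) \<noteq> P y t)"
  have "even (y + int t)" if "q y" for y
  proof (rule ccontr)
    assume odd: "odd (y + int t)"
    then have "chips f0 A0 y t = 0" by (rule even_config_chips_parity[OF f0(1)])
    moreover have "\<not> P y t" using odd assms(2) by blast
    ultimately show False using that by (simp add: q_def)
  qed
  then obtain g where g: "\<And>y. odd y \<Longrightarrow> g y = 0" "\<And>y. odd (spread g y t) \<longleftrightarrow> q y"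
    using spread_parity_surj[of q t] by metis
  let ?f = "\<lambda>x. f0 x + 2 ^ t * g x"
  show ?case
  proof (rule Suc.prems)
    show "even_config ?f" using f0(1) g(1) by (simp add: even_config_def)
    fix y s assume "s < Suc t"
    then consider "s < t" | "s = t" by linarith
    then show "odd (chips ?f A0 y s) \<longleftrightarrow> P y s"
    proof cases
      case 1
      then show ?thesis using chips_add_multiple[OF assms(1), of s t f0 g y] f0(2)[of s y] by simp
    next
      case 2
      then show ?thesis using chips_add_multiple[OF assms(1), of t t f0 g y] g(2)[of y]
        by (auto simp: q_def)
    qed
  qed
qed

section \<open>The lower bound in terms of distances\<close>

text \<open>The vertex \<open>- z\<close>, for \<open>z \<in> Z\<close>, kicks once, \<open>9 z\<^sup>2\<close> steps before time \<open>t0\<close>. During the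
  time interval the age of that kick stays between \<open>9 z\<^sup>2\<close> and \<open>10 z\<^sup>2\<close>, since \<open>T \<le> z\<^sup>2\<close>, and the
  first \<open>l z \<le> z\<close> places of the space interval are at distance between \<open>z\<close> and \<open>2 z\<close>. So
  \<open>walk_drop_ge\<close> applies to all pairs of a place and a time that have the right parity, and gives
  each the order \<open>1 / z\<^sup>2\<close>.\<close>

lemma max_discrepancy_ge:
  assumes fin: "finite Z" and T: "T \<ge> 1"
    and Z: "\<And>z. z \<in> Z \<Longrightarrow> z \<ge> 1 \<and> T \<le> z\<^sup>2 \<and> l z \<le> L \<and> l z \<le> z"
  shows "ereal (real T / 640 * (\<Sum>z\<in>Z. real (l z) / (real z)\<^sup>2)) \<le> max_discrepancy L T"
proof -
  define K where "K = Max (insert 0 Z)"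
  have K: "z \<le> K" if "z \<in> Z" for z using that fin by (simp add: K_def)
  \<comment> \<open>The starting time only has to be even and no smaller than \<open>9 z\<^sup>2\<close> for all \<open>z \<in> Z\<close>.\<close>
  define t0 where "t0 = 18 * K\<^sup>2"
  have Kt0: "9 * z\<^sup>2 + 9 * K\<^sup>2 \<le> t0" if "z \<in> Z" for z
    using power_mono[OF K[OF that], of 2] by (simp add: t0_def)
  define P where "P = (\<lambda>y s. \<exists>z\<in>Z. y = - int z \<and> s = t0 - 9 * z\<^sup>2)"
  define A0 :: "int \<Rightarrow> int" where "A0 = (\<lambda>_. 1)"
  have valid: "valid_arrows A0" by (simp add: valid_arrows_def A0_def)
  \<comment> \<open>\<open>9 z\<^sup>2\<close> and \<open>z\<close> have the same parity, so the kicks are compatible with an even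
    configuration.\<close>
  have "even (y + int s)" if P: "P y s" for y s
  proof -
    obtain z where z: "z \<in> Z" "y = - int z" "s = t0 - 9 * z\<^sup>2" using P by (auto simp: P_def)
    have "s + 9 * z\<^sup>2 = t0" using Kt0[OF z(1)] z(3) by linarith
    then have "even (s + 9 * z\<^sup>2)" by (simp add: t0_def)
    then show ?thesis using z(2) by simp
  qed
  then obtain f0 where f0: "even_config f0" "\<And>y s. s < t0 + T \<Longrightarrow> odd (chips f0 A0 y s) \<longleftrightarrow> P y s"
    using parity_forcing[OF valid, of P "t0 + T"] by metis
  have arrow: "arrow f0 A0 y s = 1" if "\<And>r. r < s \<Longrightarrow> \<not> P y r" "s < t0 + T" for y s
    using that
  proof (induction s)
    case (Suc s)
    then have "even (chips f0 A0 y s)" using f0(2)[of s y] by simp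
    then show ?case using Suc by simp
  qed (simp add: A0_def)
  have kick: "kick f0 A0 y s = (if P y s then 1 else 0)" if "s < t0 + T" for y s
  proof (cases "P y s")
    case True
    have "arrow f0 A0 y s = 1"
    proof (rule arrow)
      show "\<not> P y r" if "r < s" for r using that True by (auto simp: P_def)
    qed (rule that)
    then show ?thesis using True f0(2)[OF that, of y] by (simp add: kick_def mod_2_eq_odd)
  next
    case False
    then show ?thesis using f0(2)[OF that, of y] by (simp add: kick_def mod_2_eq_odd)
  qed
  define X S where "X = {0..<int L}" and "S = {t0..<t0 + T}"
  define N where "N = int L + int t0 + int T + int K"
  define V where "V = (\<lambda>z w. \<Sum>t\<in>S. walk_drop w (t - Suc (t0 - 9 * z\<^sup>2)))"
  have infl: "influence f0 A0 S (- int z) w = V z w" if "z \<in> Z" for z w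
    unfolding influence_def V_def
  proof (intro sum.cong refl)
    fix t assume t: "t \<in> S"
    have "z\<^sup>2 \<ge> 1" using Z[OF that] by simp
    moreover have "t0 \<le> t" using t by (simp add: S_def)
    ultimately have lt: "t0 - 9 * z\<^sup>2 < t" using Kt0[OF that] by linarith
    have P: "P (- int z) s \<longleftrightarrow> s = t0 - 9 * z\<^sup>2" for s using that by (auto simp: P_def)
    have "(\<Sum>s<t. kick f0 A0 (- int z) s * walk_drop w (t - Suc s)) =
        (\<Sum>s<t. if s = t0 - 9 * z\<^sup>2 then walk_drop w (t - Suc s) else 0)"
      using t by (intro sum.cong refl) (auto simp: kick P S_def)
    also have "\<dots> = walk_drop w (t - Suc (t0 - 9 * z\<^sup>2))" using lt by simp
    finally show "(\<Sum>s<t. kick f0 A0 (- int z) s * walk_drop w (t - Suc s)) = \<dots>" .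
  qed
  have infl_0: "influence f0 A0 S y w = 0" if "y \<notin> (\<lambda>z. - int z) ` Z" for y w
  proof -
    have "\<not> P y s" for s using that by (auto simp: P_def)
    then show ?thesis by (auto simp: influence_def S_def kick intro!: sum.neutral)
  qed
  have "real (chips_on f0 A0 X S) - expected_on f0 X S =
      (\<Sum>y\<in>{-N..N}. \<Sum>x\<in>X. influence f0 A0 S y (x - y)) / 2"
    by (rule discrepancy_on[OF valid]) (auto simp: X_def S_def N_def)
  also have "(\<Sum>y\<in>{-N..N}. \<Sum>x\<in>X. influence f0 A0 S y (x - y)) =
      (\<Sum>y\<in>(\<lambda>z. - int z) ` Z. \<Sum>x\<in>X. influence f0 A0 S y (x - y))"
    using K by (intro sum.mono_neutral_right) (force simp: N_def infl_0)+
  also have "\<dots> = (\<Sum>z\<in>Z. \<Sum>x\<in>X. V z (x + int z))"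
    by (subst sum.reindex) (auto simp: inj_on_def infl)
  finally have disc: "real (chips_on f0 A0 X S) - expected_on f0 X S =
    (\<Sum>z\<in>Z. \<Sum>x\<in>X. V z (x + int z)) / 2" .
  have V_ge: "real (l z) * real T / (320 * (real z)\<^sup>2) \<le> (\<Sum>x\<in>X. V z (x + int z))" if zZ: "z \<in> Z" for z
  proof -
    have z: "z \<ge> 1" "T \<le> z\<^sup>2" "l z \<le> L" "l z \<le> z" using Z[OF zZ] by auto
    \<comment> \<open>Even places and even times after \<open>t0\<close> always have the right parity; rounding up keeps at
      least a quarter of all pairs.\<close>
    define I J where "I = {..<(l z + 1) div 2}" and "J = {..<(T + 1) div 2}"
    have drop_ge: "1 / (80 * (real z)\<^sup>2) \<le> walk_drop (2 * int i + int z) (t0 + 2 * j - Suc (t0 - 9 * z\<^sup>2))"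
      if "i \<in> I" "j \<in> J" for i j
    proof -
      define n z' where "n = 9 * z\<^sup>2 + 2 * j" and "z' = 2 * i + z"
      have "2 * i < l z" "2 * j < T" using that by (auto simp: I_def J_def)
      then have z': "z \<le> z'" "z' \<le> 2 * z" and n: "9 * z\<^sup>2 \<le> n" "n \<le> 10 * z\<^sup>2"
        using z by (auto simp: n_def z'_def)
      have z2: "z\<^sup>2 \<ge> 1" using z by simp
      have n1: "n \<ge> 1" using n z2 by linarith
      then obtain u where u: "n = Suc u" by (cases n) auto
      have u_eq: "t0 + 2 * j - Suc (t0 - 9 * z\<^sup>2) = u" using u Kt0[OF zZ] by (simp add: n_def)
      have "z'\<^sup>2 \<le> (2 * z)\<^sup>2" using z'(2) by (rule power_mono) simp
      then have "2 * z'\<^sup>2 \<le> n" using n by (simp add: power_mult_distrib)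
      moreover have "even (n + z')" by (simp add: n_def z'_def)
      ultimately have ge: "real z' / (2 * real n * sqrt (real n)) \<le> walk_drop (int z') u"
        using walk_drop_ge[of z' u] z z' u by simp
      have nr: "real n \<le> 10 * (real z)\<^sup>2" using of_nat_mono[OF n(2), where 'a = real] by simp
      have "real n \<le> (4 * real z)\<^sup>2"
        using nr zero_le_power2[of "real z"] unfolding power_mult_distrib by simp
      then have "sqrt (real n) \<le> 4 * real z" by (intro real_le_lsqrt) auto
      then have "real n * sqrt (real n) \<le> 10 * (real z)\<^sup>2 * (4 * real z)"
        using nr by (intro mult_mono) auto
      then have "2 * (real n * sqrt (real n)) \<le> 80 * (real z)\<^sup>2 * real z" by (simp add: mult_ac)
      then have "real z / (80 * (real z)\<^sup>2 * real z) \<le> real z' / (2 * (real n * sqrt (real n)))"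
        using z' n1 z by (intro frac_le) auto
      then show ?thesis using ge z u_eq by (simp add: z'_def mult.assoc)
    qed
    have "real (l z) * real T / (320 * (real z)\<^sup>2) = (real (l z) / 2) * (real T / 2) * (1 / (80 * (real z)\<^sup>2))"
      by simp
    also have "\<dots> \<le> real (card I) * real (card J) * (1 / (80 * (real z)\<^sup>2))"
      by (intro mult_right_mono mult_mono) (auto simp: I_def J_def)
    also have "\<dots> = (\<Sum>i\<in>I. \<Sum>j\<in>J. 1 / (80 * (real z)\<^sup>2))" by simp
    also have "\<dots> \<le> (\<Sum>i\<in>I. \<Sum>j\<in>J. walk_drop (2 * int i + int z) (t0 + 2 * j - Suc (t0 - 9 * z\<^sup>2)))"
      by (intro sum_mono drop_ge)
    also have "\<dots> \<le> (\<Sum>i\<in>I. V z (2 * int i + int z))"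
    proof (intro sum_mono)
      fix i
      have "(\<Sum>j\<in>J. walk_drop (2 * int i + int z) (t0 + 2 * j - Suc (t0 - 9 * z\<^sup>2))) =
          (\<Sum>t\<in>(\<lambda>j. t0 + 2 * j) ` J. walk_drop (2 * int i + int z) (t - Suc (t0 - 9 * z\<^sup>2)))"
        by (subst sum.reindex) (auto simp: inj_on_def)
      also have "\<dots> \<le> V z (2 * int i + int z)"
        unfolding V_def by (rule sum_mono2) (auto simp: S_def J_def intro!: walk_drop_nonneg)
      finally show "(\<Sum>j\<in>J. walk_drop (2 * int i + int z) (t0 + 2 * j - Suc (t0 - 9 * z\<^sup>2)))
          \<le> V z (2 * int i + int z)" .
    qed
    also have "\<dots> = (\<Sum>x\<in>(\<lambda>i. 2 * int i) ` I. V z (x + int z))"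
      by (subst sum.reindex) (auto simp: inj_on_def)
    also have "\<dots> \<le> (\<Sum>x\<in>X. V z (x + int z))"
      using z by (intro sum_mono2) (auto simp: X_def I_def V_def intro!: walk_drop_nonneg sum_nonneg)
    finally show ?thesis .
  qed
  have "real T / 640 * (\<Sum>z\<in>Z. real (l z) / (real z)\<^sup>2) =
      (\<Sum>z\<in>Z. real (l z) * real T / (320 * (real z)\<^sup>2)) / 2"
    by (simp add: sum_distrib_left sum_divide_distrib mult_ac)
  also have "\<dots> \<le> real (chips_on f0 A0 X S) - expected_on f0 X S"
    unfolding disc by (intro divide_right_mono sum_mono V_ge) auto
  also have "\<dots> \<le> \<bar>real (chips_on f0 A0 X S) - expected_on f0 X S\<bar>" by simp
  finally have "ereal (real T / 640 * (\<Sum>z\<in>Z. real (l z) / (real z)\<^sup>2)) \<le>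
      ereal \<bar>real (chips_on f0 A0 X S) - expected_on f0 X S\<bar>" by simp
  also have "\<dots> \<le> max_discrepancy L T"
    unfolding max_discrepancy_def
  proof (rule Sup_upper, rule CollectI, intro exI conjI)
    show "int_interval L X" by (auto simp: int_interval_def X_def intro!: exI[of _ 0])
    show "nat_interval T S" by (auto simp: nat_interval_def S_def)
  qed (use valid f0(1) in auto)
  finally show ?thesis .
qed

section \<open>Evaluation of the sums over distances\<close>

lemma sum_inverse_squares_le:
  assumes "R \<ge> 1"
  shows "(\<Sum>z\<in>{R<..M}. 1 / (real z)\<^sup>2) \<le> 1 / real R"
proof (cases "R \<le> M")
  case True
  then have "(\<Sum>z\<in>{R<..M}. 1 / (real z)\<^sup>2) \<le> 1 / real R - 1 / real M"
  proof (induction M rule: dec_induct)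
    case (step n)
    have "{R<..Suc n} = insert (Suc n) {R<..n}" using step by auto
    moreover have "1 / (real (Suc n))\<^sup>2 \<le> 1 / real n - 1 / real (Suc n)"
      using step assms by (simp add: divide_simps power2_eq_square)
    ultimately show ?case using step by simp
  qed simp
  then show ?thesis by (smt (verit) of_nat_0_le_iff zero_le_divide_1_iff)
qed simp

lemma sum_inverse_le_ln:
  assumes "1 \<le> R" "R \<le> L"
  shows "(\<Sum>z\<in>{R<..L}. 1 / real z) \<le> ln (real L / real R)"
  using assms(2)
proof (induction L rule: dec_induct)
  case base
  then show ?case using assms by simp
next
  case (step n)
  have n: "real n > 0" using step assms by simp
  have "ln (real n / real (Suc n)) \<le> real n / real (Suc n) - 1"
    using n by (intro ln_le_minus_one) simp
  also have "\<dots> = - (1 / real (Suc n))" by (simp add: field_simps)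
  finally have "1 / real (Suc n) \<le> ln (real (Suc n)) - ln (real n)"
    using n by (simp add: ln_div del: of_nat_Suc)
  moreover have "{R<..Suc n} = insert (Suc n) {R<..n}" using step by auto
  moreover have "ln (real m / real R) = ln (real m) - ln (real R)" if "m \<ge> 1" for m
    using that assms by (simp add: ln_div)
  ultimately show ?case using step assms by (simp del: of_nat_Suc)
qed

lemma ln_le_sum_inverse:
  assumes "1 \<le> R" "R \<le> L"
  shows "ln (real (Suc L) / real R) \<le> (\<Sum>z\<in>{R..L}. 1 / real z)"
  using assms(2)
proof (induction L rule: dec_induct)
  case base
  have "ln (real (Suc R) / real R) \<le> real (Suc R) / real R - 1"
    using assms by (intro ln_le_minus_one) simp
  also have "\<dots> = 1 / real R" using assms by (simp add: field_simps)
  finally show ?case by simp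
next
  case (step n)
  have "ln (real (Suc (Suc n)) / real (Suc n)) \<le> real (Suc (Suc n)) / real (Suc n) - 1"
    by (intro ln_le_minus_one) simp
  also have "\<dots> = 1 / real (Suc n)" by (simp add: field_simps)
  finally have "ln (real (Suc (Suc n))) - ln (real (Suc n)) \<le> 1 / real (Suc n)"
    by (simp add: ln_div del: of_nat_Suc)
  moreover have "{R..Suc n} = insert (Suc n) {R..n}" using step by auto
  moreover have "ln (real (Suc m) / real R) = ln (real (Suc m)) - ln (real R)" for m
    using assms by (simp add: ln_div del: of_nat_Suc)
  ultimately show ?case using step by (simp del: of_nat_Suc)
qed

lemma discrepancy_weight_nonneg: "discrepancy_weight L T z \<ge> 0"
  by (simp add: discrepancy_weight_def)

text \<open>Of the two bounds for the influence, the constant one is used for \<open>z \<le> R\<close> and the other one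
  beyond, where \<open>R\<close> is of order \<open>\<surd>T\<close>; the number of vertices is bounded by
  \<open>2 L\<close> throughout.\<close>

lemma sum_weight_narrow:
  assumes "R \<ge> 1" "sqrt (real T) \<le> real R" "real R \<le> 2 * sqrt (real T)"
  shows "(\<Sum>z\<in>{1..M}. discrepancy_weight L T z) \<le> 176 * real L * sqrt (real T)"
proof -
  have "(\<Sum>z\<in>{1..M}. discrepancy_weight L T z) \<le> (\<Sum>z\<in>{1..R} \<union> {R<..M}. discrepancy_weight L T z)"
    by (rule sum_mono2) (auto simp: discrepancy_weight_nonneg)
  also have "\<dots> = (\<Sum>z\<in>{1..R}. discrepancy_weight L T z) + (\<Sum>z\<in>{R<..M}. discrepancy_weight L T z)"
    by (rule sum.union_disjoint) auto
  also have "(\<Sum>z\<in>{1..R}. discrepancy_weight L T z) \<le> (\<Sum>z\<in>{1..R}. real L * 4)"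
    unfolding discrepancy_weight_def by (intro sum_mono mult_mono) auto
  also have "\<dots> \<le> real L * 4 * (2 * sqrt (real T))"
    using mult_left_mono[OF assms(3), of "real L * 4"] by (simp add: mult_ac)
  also have "(\<Sum>z\<in>{R<..M}. discrepancy_weight L T z) \<le> (\<Sum>z\<in>{R<..M}. real L * (168 * real T / (real z)\<^sup>2))"
    unfolding discrepancy_weight_def by (intro sum_mono mult_mono) auto
  also have "\<dots> = 168 * real L * real T * (\<Sum>z\<in>{R<..M}. 1 / (real z)\<^sup>2)"
    by (simp add: sum_distrib_left mult_ac)
  also have "\<dots> \<le> 168 * real L * real T * (1 / real R)"
    using sum_inverse_squares_le[OF assms(1)] by (intro mult_left_mono) auto
  also have "\<dots> \<le> 168 * real L * sqrt (real T)"
  proof -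
    have "real T = sqrt (real T) * sqrt (real T)" by simp
    also have "\<dots> \<le> sqrt (real T) * real R" using assms by (intro mult_left_mono) auto
    finally have "real T / real R \<le> sqrt (real T)" using assms(1) by (simp add: divide_le_eq)
    from mult_left_mono[OF this, of "168 * real L"] show ?thesis by simp
  qed
  finally show ?thesis by simp
qed

text \<open>As before, but the number of vertices is now bounded by \<open>4 z\<close> for \<open>z \<le> L\<close>, which gives the terms
  \<open>T / z\<close> of a harmonic sum between \<open>R\<close> and \<open>L\<close>.\<close>

lemma sum_weight_wide:
  assumes "R \<ge> 1" "sqrt (real T) \<le> real R" "real R \<le> 2 * sqrt (real T)" "R \<le> L" "T \<ge> 1"
  shows "(\<Sum>z\<in>{1..M}. discrepancy_weight L T z) \<le> 200 * real T + 336 * real T * ln (real L / sqrt (real T))"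
proof -
  have "(\<Sum>z\<in>{1..M}. discrepancy_weight L T z) \<le> (\<Sum>z\<in>({1..R} \<union> {R<..L}) \<union> {L<..M}. discrepancy_weight L T z)"
    by (rule sum_mono2) (auto simp: discrepancy_weight_nonneg)
  also have "\<dots> = (\<Sum>z\<in>{1..R} \<union> {R<..L}. discrepancy_weight L T z) + (\<Sum>z\<in>{L<..M}. discrepancy_weight L T z)"
    using assms by (intro sum.union_disjoint) auto
  also have "(\<Sum>z\<in>{1..R} \<union> {R<..L}. discrepancy_weight L T z) =
      (\<Sum>z\<in>{1..R}. discrepancy_weight L T z) + (\<Sum>z\<in>{R<..L}. discrepancy_weight L T z)"
    by (intro sum.union_disjoint) auto
  also have "(\<Sum>z\<in>{1..R}. discrepancy_weight L T z) \<le> (\<Sum>z\<in>{1..R}. (2 * real R) * 4)"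
    unfolding discrepancy_weight_def by (intro sum_mono mult_mono) auto
  also have "\<dots> = 8 * (real R)\<^sup>2" by (simp add: power2_eq_square)
  also have "\<dots> \<le> 8 * (2 * sqrt (real T))\<^sup>2" using assms by (intro mult_left_mono power_mono) auto
  also have "\<dots> = 32 * real T" by (simp add: power_mult_distrib)
  also have "(\<Sum>z\<in>{R<..L}. discrepancy_weight L T z) \<le> (\<Sum>z\<in>{R<..L}. 336 * real T * (1 / real z))"
  proof (rule sum_mono)
    fix z assume z: "z \<in> {R<..L}"
    have "discrepancy_weight L T z \<le> (2 * real z) * (168 * real T / (real z)\<^sup>2)"
      unfolding discrepancy_weight_def by (intro mult_mono) auto
    also have "\<dots> = 336 * real T * (1 / real z)" using z by (simp add: power2_eq_square)
    finally show "discrepancy_weight L T z \<le> 336 * real T * (1 / real z)" .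
  qed
  also have "\<dots> = 336 * real T * (\<Sum>z\<in>{R<..L}. 1 / real z)" by (simp add: sum_distrib_left)
  also have "\<dots> \<le> 336 * real T * ln (real L / sqrt (real T))"
  proof (intro mult_left_mono)
    have "(\<Sum>z\<in>{R<..L}. 1 / real z) \<le> ln (real L / real R)"
      using assms by (intro sum_inverse_le_ln) auto
    also have "\<dots> \<le> ln (real L / sqrt (real T))"
      using assms by (subst ln_le_cancel_iff) (auto intro!: divide_left_mono)
    finally show "(\<Sum>z\<in>{R<..L}. 1 / real z) \<le> ln (real L / sqrt (real T))" .
  qed simp
  also have "(\<Sum>z\<in>{L<..M}. discrepancy_weight L T z) \<le> (\<Sum>z\<in>{L<..M}. real L * (168 * real T / (real z)\<^sup>2))"
    unfolding discrepancy_weight_def by (intro sum_mono mult_mono) auto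
  also have "\<dots> = 168 * real L * real T * (\<Sum>z\<in>{L<..M}. 1 / (real z)\<^sup>2)"
    by (simp add: sum_distrib_left mult_ac)
  also have "\<dots> \<le> 168 * real L * real T * (1 / real L)"
    using assms by (intro mult_left_mono sum_inverse_squares_le) auto
  also have "\<dots> = 168 * real T" using assms by simp
  finally show ?thesis by simp
qed

text \<open>Rounding \<open>\<surd>T\<close> up to \<open>R\<close> may lose a factor of almost \<open>2\<close> inside the logarithm, which is fatal when
  \<open>L = 2 \<surd>T\<close>. The sum including both ends compensates: for \<open>r = \<surd>T\<close> and \<open>p\<^sup>2 = L / r\<close> with
  \<open>r, p \<ge> 1\<close>, the ratio \<open>(L + 1) / (r + 1)\<close> is still at least \<open>p\<close>.\<close>

lemma ln_ratio_le_sum_inverse: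
  assumes "T \<ge> 1" "2 * sqrt (real T) \<le> real L" "R \<ge> 1" "real R \<le> sqrt (real T) + 1" "R \<le> L"
  shows "ln (real L / sqrt (real T)) / 2 \<le> (\<Sum>z\<in>{R..L}. 1 / real z)"
proof -
  define r p where "r = sqrt (real T)" and "p = sqrt (real L / r)"
  have r: "r \<ge> 1" using assms by (simp add: r_def)
  have q: "real L / r \<ge> 1" using assms r by (simp add: r_def field_simps)
  then have p: "p \<ge> 1" by (simp add: p_def)
  have L: "real L = p\<^sup>2 * r" using r q by (simp add: p_def)
  have "0 \<le> (p * r - 1) * (p - 1)" using r p mult_mono[of 1 p 1 r] by (intro mult_nonneg_nonneg) auto
  then have "p * (r + 1) \<le> real (Suc L)" by (simp add: L power2_eq_square algebra_simps)
  moreover have "p * real R \<le> p * (r + 1)" using assms p by (intro mult_left_mono) (auto simp: r_def)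
  ultimately have "p \<le> real (Suc L) / real R" using assms(3) by (subst le_divide_eq) (simp add: mult.commute)
  then have "ln p \<le> ln (real (Suc L) / real R)" using p assms(3) by (subst ln_le_cancel_iff) auto
  also have "\<dots> \<le> (\<Sum>z\<in>{R..L}. 1 / real z)" using assms by (intro ln_le_sum_inverse)
  also have "ln p = ln (real L / r) / 2" using q unfolding p_def by (intro ln_sqrt) simp
  finally show ?thesis by (simp add: r_def)
qed

section \<open>The discrepancy on space-time rectangles\<close>

theorem theorem11:
  shows "\<exists>(C::real) (c::real). C > 0 \<and> c > 0 \<and>
    (\<forall>(L::nat) (T::nat). L \<ge> 1 \<longrightarrow> T \<ge> 1 \<longrightarrow>
      (if real L \<ge> 2 * sqrt (real T)
       then ereal (c * real T * ln (real L / sqrt (real T))) \<le> max_discrepancy L T \<and>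
            max_discrepancy L T \<le> ereal (C * real T * ln (real L / sqrt (real T)))
       else ereal (c * real L * sqrt (real T)) \<le> max_discrepancy L T \<and>
            max_discrepancy L T \<le> ereal (C * real L * sqrt (real T))))"
\<comment> \<open>\<open>736 = 336 + 2 * 200\<close>, as the logarithm is at least \<open>1/2\<close>; \<open>20480 = 640 * 32\<close> comes from
  the case \<open>L < 2 \<surd>T\<close>.\<close>
proof (rule exI[of _ "736"], rule exI[of _ "1 / 20480"], intro conjI allI impI)
  fix L T :: nat
  assume L: "L \<ge> 1" and T: "T \<ge> 1"
  define r where "r = sqrt (real T)"
  have r: "r \<ge> 1" and rr: "r * r = real T" using T by (simp_all add: r_def)
  define R where "R = nat \<lceil>r\<rceil>"
  have R: "r \<le> real R" "real R \<le> r + 1" using r by (simp_all add: R_def of_nat_nat)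
  then have R1: "R \<ge> 1" and R2: "real R \<le> 2 * r" using r by linarith+
  have TR: "T \<le> z\<^sup>2" if "R \<le> z" for z
  proof -
    have "r \<le> real z" using R that by linarith
    then have "real T \<le> (real z)\<^sup>2" using r by (simp flip: rr add: power2_eq_square mult_mono)
    then show ?thesis by (simp flip: of_nat_power)
  qed
  show "if real L \<ge> 2 * sqrt (real T)
       then ereal (1 / 20480 * real T * ln (real L / sqrt (real T))) \<le> max_discrepancy L T \<and>
            max_discrepancy L T \<le> ereal (736 * real T * ln (real L / sqrt (real T)))
       else ereal (1 / 20480 * real L * sqrt (real T)) \<le> max_discrepancy L T \<and>
            max_discrepancy L T \<le> ereal (736 * real L * sqrt (real T))"
  proof (cases "real L \<ge> 2 * r")
    case True
    have RL: "R \<le> L" using True R2 by linarith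
    define q where "q = ln (real L / r)"
    have "2 \<le> real L / r" using True r by (simp add: le_divide_eq)
    then have "ln 2 \<le> q" by (simp add: q_def)
    then have q: "1 / 2 \<le> q" using ln2_ge_two_thirds by linarith
    have "1 / 20480 * real T * q \<le> real T / 640 * (q / 2)" using q by simp
    also have "q / 2 \<le> (\<Sum>z\<in>{R..L}. 1 / real z)"
      unfolding q_def r_def using T True R R1 RL by (intro ln_ratio_le_sum_inverse) (auto simp: r_def)
    also have "(\<Sum>z\<in>{R..L}. 1 / real z) = (\<Sum>z\<in>{R..L}. real z / (real z)\<^sup>2)"
      by (intro sum.cong refl) (simp add: power2_eq_square)
    finally have "ereal (1 / 20480 * real T * q) \<le> ereal (real T / 640 * (\<Sum>z\<in>{R..L}. real z / (real z)\<^sup>2))"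
      by (simp add: mult_left_mono)
    also have "\<dots> \<le> max_discrepancy L T"
      using T TR R1 by (intro max_discrepancy_ge) auto
    finally have lower: "ereal (1 / 20480 * real T * q) \<le> max_discrepancy L T" .
    have "max_discrepancy L T \<le> ereal (200 * real T + 336 * real T * q)"
      unfolding q_def r_def
      by (intro max_discrepancy_le sum_weight_wide[of R]) (use R R1 R2 RL T in \<open>auto simp: r_def\<close>)
    also have "200 * real T + 336 * real T * q \<le> 736 * real T * q"
      using mult_left_mono[OF q, of "400 * real T"] by simp
    finally show ?thesis using True lower by (simp add: q_def r_def)
  next
    case False
    have "real L * r / 20480 = real T / 640 * (r * (real L / (32 * real T)))" using T by simp
    also have "\<dots> \<le> real T / 640 * (\<Sum>z\<in>{R..2 * R}. real (min L z) / (real z)\<^sup>2)"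
    proof (rule mult_left_mono)
      have "r * (real L / (32 * real T)) \<le> real (card {R..2 * R}) * (real L / (32 * real T))"
        using R by (intro mult_right_mono) auto
      also have "\<dots> = (\<Sum>z\<in>{R..2 * R}. real L / (32 * real T))" by simp
      also have "\<dots> \<le> (\<Sum>z\<in>{R..2 * R}. real (min L z) / (real z)\<^sup>2)"
      proof (rule sum_mono)
        fix z assume z: "z \<in> {R..2 * R}"
        \<comment> \<open>Here \<open>z \<ge> \<surd>T > L / 2\<close>.\<close>
        have "real L / 2 \<le> real (min L z)" using z R False by (auto simp: min_def)
        moreover have "real z \<le> 4 * r" using z R2 by auto
        then have "(real z)\<^sup>2 \<le> (4 * r)\<^sup>2" by (intro power_mono) auto
        then have "(real z)\<^sup>2 \<le> 16 * real T" by (simp add: power2_eq_square flip: rr)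
        ultimately have "(real L / 2) / (16 * real T) \<le> real (min L z) / (real z)\<^sup>2"
          using z R1 by (intro frac_le) auto
        then show "real L / (32 * real T) \<le> real (min L z) / (real z)\<^sup>2" by simp
      qed
      finally show "r * (real L / (32 * real T)) \<le> (\<Sum>z\<in>{R..2 * R}. real (min L z) / (real z)\<^sup>2)" .
    qed simp
    finally have "ereal (real L * r / 20480) \<le>
        ereal (real T / 640 * (\<Sum>z\<in>{R..2 * R}. real (min L z) / (real z)\<^sup>2))" by simp
    also have "\<dots> \<le> max_discrepancy L T"
      using T TR R1 by (intro max_discrepancy_ge) auto
    finally have lower: "ereal (real L * r / 20480) \<le> max_discrepancy L T" .
    have "max_discrepancy L T \<le> ereal (176 * real L * r)"
      unfolding r_def
      by (intro max_discrepancy_le sum_weight_narrow[of R]) (use R R1 R2 in \<open>auto simp: r_def\<close>)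
    also have "176 * real L * r \<le> 736 * real L * r" using r by (intro mult_right_mono) auto
    finally show ?thesis using False lower by (simp add: r_def)
  qed
qed simp_all

end
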